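(* Let $\varphi$ be an Orlicz function. Let $I=(0,a)$, $0<a\le\infty$, and let $w$ be a decreasing weight function on $I$. Then for any $f\in L^0$, $$\int_I \varphi\left(\frac{f^*}{w}\right) w = \inf\left\{\int_I \varphi\left(\frac{|f|}{v}\right) v : v^*\le w,\ v\ge 0\right\}.$$ Let $w=\{w(n)\}$ be a decreasing weight sequence. Then for any real sequence $x=\{x(n)\}$, $$\sum_{n=1}^\infty \varphi\left(\frac{x^*(n)}{w(n)}\right) w(n) = \inf\left\{\sum_{n=1}^\infty \varphi\left(\frac{|x(n)|}{v(n)}\right) v(n) : v^*\le w,\ v\ge 0\right\}.$$
   Context: An Orlicz function is a convex, strictly increasing $\varphi:\mathbb{R}_+\to\mathbb{R}_+$ with $\varphi(0)=0$. "Decreasing" means non-increasing. $L^0$ is the set of Lebesgue measurable $f:I\to\mathbb{R}$. For $f\in L^0$, $d_f(s)=|\{t\in I:|f(t)|>s\}|$ and $f^*(t)=\inf\{s\ge0:d_f(s)\le t\}$, $t\in I$. For a sequence $x$, $d_x(s)=|\{k\in\mathbb{N}:|x(k)|>s\}|$ and $x^*(n)=\inf\{s>0:d_x(s)\le n-1\}$ ($\inf\emptyset=\infty$). A weight function (sequence) is a non-negative decreasing real-valued measurable function on $I$ (sequence). Convention: if $v(t)=0$ then $\varphi(|f(t)|/v(t))v(t)$ is $0$ if $f(t)=0$ and $\infty$ if $f(t)\ne0$ (likewise for $f^*,w$ and for sequences); the expression is $\infty$ where $f^*$ or $x^*$ is $\infty$. Integrals and sums take values in $[0,\infty]$. *)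

theory Defs
  imports "HOL-Analysis.Analysis"
begin

definition orlicz_function :: "(real \<Rightarrow> real) \<Rightarrow> bool" where
  "orlicz_function \<phi> \<longleftrightarrow>
     \<phi> ` {0..} \<subseteq> {0..} \<and> convex_on {0..} \<phi> \<and> strict_mono_on {0..} \<phi> \<and> \<phi> 0 = 0"

(* Intervals (0,a) are written einterval 0 a with a :: ereal, which covers a = \<infinity>.
   Functions on I are total; only their values on I matter. *)

definition L0 :: "real set \<Rightarrow> (real \<Rightarrow> real) set" where
  "L0 I = borel_measurable (lebesgue_on I)"

definition distr_fun :: "real set \<Rightarrow> (real \<Rightarrow> real) \<Rightarrow> real \<Rightarrow> ennreal" where
  "distr_fun I f s = emeasure lebesgue {t \<in> I. \<bar>f t\<bar> > s}"

(* Rearrangements are ennreal-valued, so that Inf {} = \<infinity>. *)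
definition rearr_fun :: "real set \<Rightarrow> (real \<Rightarrow> real) \<Rightarrow> real \<Rightarrow> ennreal" where
  "rearr_fun I f t = Inf {ennreal s | s. 0 \<le> s \<and> distr_fun I f s \<le> ennreal t}"

definition weight_function :: "real set \<Rightarrow> (real \<Rightarrow> real) \<Rightarrow> bool" where
  "weight_function I w \<longleftrightarrow>
     w \<in> borel_measurable (lebesgue_on I) \<and> (\<forall>t\<in>I. 0 \<le> w t) \<and> antimono_on I w"

(* Sequences are indexed by {1..}; the value at 0 is irrelevant. *)

definition distr_seq :: "(nat \<Rightarrow> real) \<Rightarrow> real \<Rightarrow> ennreal" where
  "distr_seq x s = emeasure (count_space UNIV) {k. 1 \<le> k \<and> \<bar>x k\<bar> > s}"

definition rearr_seq :: "(nat \<Rightarrow> real) \<Rightarrow> nat \<Rightarrow> ennreal" where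
  "rearr_seq x n = Inf {ennreal s | s. 0 < s \<and> distr_seq x s \<le> of_nat (n - 1)}"

definition weight_sequence :: "(nat \<Rightarrow> real) \<Rightarrow> bool" where
  "weight_sequence w \<longleftrightarrow> (\<forall>n\<ge>1. 0 \<le> w n) \<and> antimono_on {1..} w"

(* The value of \<phi>(y/v) v for y in [0,\<infinity>] and real v \<ge> 0, with the conventions for
   y = \<infinity> (value \<infinity>, also when v = 0) and for v = 0. *)
definition orlicz_term :: "(real \<Rightarrow> real) \<Rightarrow> ennreal \<Rightarrow> real \<Rightarrow> ennreal" where
  "orlicz_term \<phi> y v =
     (if y = \<infinity> then \<infinity>
      else if v = 0 then (if y = 0 then 0 else \<infinity>)
      else ennreal (\<phi> (enn2real y / v) * v))"

end

theory Submission
  imports Defs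
begin

text \<open>
The lower bound rests on the submodularity of the perspective \<open>F(y, v) = v \<phi>(y / v)\<close>: for
\<open>y < y'\<close> the increment \<open>F(y', v) - F(y, v)\<close> decreases in \<open>v\<close>. Discretising \<open>y\<close> therefore writes
\<open>\<integral> F(|f|, v)\<close> as a sum of integrals of decreasing functions of \<open>v\<close> over level sets of \<open>|f|\<close>, and a
layer-cake argument reduces everything to the inequality
\<open>|{f* > s, w \<in> D}| \<le> |{|f| > s, v \<in> D}|\<close> for down-sets \<open>D\<close>. It holds because the sets \<open>{f* > s}\<close> and
\<open>{w \<notin> D}\<close> are nested initial segments with \<open>|{v \<notin> D}| \<le> |{w \<notin> D}|\<close>.

If the left-hand side is finite, the infimum is attained: all level sets \<open>{|f| > s}\<close>, \<open>s > 0\<close>, then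
have finite measure, so ranking the points of the support by decreasing \<open>|f|\<close>, ties broken by position,
gives a measure-preserving map \<open>\<tau>\<close> onto an initial segment (Ryff) with \<open>|f| \<le> f* \<circ> \<tau>\<close> almost everywhere,
and \<open>v = w \<circ> \<tau>\<close> works.
\<close>

subsection \<open>The perspective of an Orlicz function\<close>

text \<open>The down-sets \<open>D\<close> are superlevel sets of the increments as functions of
  \<open>v\<close>; these can be open or closed half-lines, so the comparison of level sets is
  stated for all down-sets at once. It needs no finiteness: the only danger is a difference of
  infinite measures, and an initial segment of infinite measure is already everything.

  Attainment does need finiteness, because a point behind infinitely much mass has no finite rank. A
  finite left-hand side excludes this: away from the origin a decreasing \<open>w\<close> is
  bounded, so a level set of infinite measure would keep the integrand above a positive constant on
  a set of infinite measure.

  For sequences the lower bound is the same argument for counting measure, but ranks are plain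
  cardinalities, and \<open>|x|\<close> is dominated by the rearrangement at the rank for every
  index of the support instead of almost everywhere.\<close>

locale orlicz =
  fixes \<phi> :: "real \<Rightarrow> real"
  assumes orlicz: "orlicz_function \<phi>"
begin

lemma phi_zero [simp]: "\<phi> 0 = 0"
  using orlicz by (simp add: orlicz_function_def)

lemma phi_less: "0 \<le> u \<Longrightarrow> u < u' \<Longrightarrow> \<phi> u < \<phi> u'"
  using orlicz by (auto simp: orlicz_function_def strict_mono_on_def)

lemma phi_mono: "0 \<le> u \<Longrightarrow> u \<le> u' \<Longrightarrow> \<phi> u \<le> \<phi> u'"
  using phi_less by (cases "u = u'") (auto intro: less_imp_le)

lemma phi_convex: "convex_on {0..} \<phi>"
  using orlicz by (simp add: orlicz_function_def)

text \<open>Moving one endpoint at a time is the three-slope inequality; the chord from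
  \<open>a\<close> to \<open>d\<close> is the intermediate stage.\<close>

lemma phi_slope_mono:
  assumes "0 \<le> a" "a < b" "a \<le> c" "b \<le> d" "c < d"
  shows "(\<phi> b - \<phi> a) / (b - a) \<le> (\<phi> d - \<phi> c) / (d - c)"
proof -
  have *: "(\<phi> y - \<phi> x) / (y - x) = (\<phi> x - \<phi> y) / (x - y)" for x y
    by (metis minus_diff_eq minus_divide_divide)
  have "(\<phi> b - \<phi> a) / (b - a) \<le> (\<phi> d - \<phi> a) / (d - a)"
  proof (cases "b = d")
    case False
    then show ?thesis
      using convex_on_slope_le(1)[OF phi_convex, of a d b] assms by (simp add: *[of a])
  qed simp
  also have "\<dots> \<le> (\<phi> d - \<phi> c) / (d - c)"
  proof (cases "a = c")
    case False
    then show ?thesis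
      using convex_on_slope_le(2)[OF phi_convex, of a d c] assms by (simp add: *[of _ d])
  qed simp
  finally show ?thesis .
qed

text \<open>Serves the case \<open>y = \<infinity>\<close>: it forces \<open>\<phi>\<close> to be
  unbounded.\<close>

lemma phi_superlinear:
  assumes "1 \<le> u"
  shows "u * \<phi> 1 \<le> \<phi> u"
  using phi_slope_mono[of 0 1 0 u] assms by (simp add: field_simps)

text \<open>Nothing is known about \<open>\<phi>\<close> to the left of 0, so two-sided continuity
  is claimed at interior points only.\<close>

lemma isCont_phi:
  assumes "0 < u"
  shows "isCont \<phi> u"
proof -
  have "continuous_on {0<..} \<phi>"
    by (rule convex_on_continuous) (auto intro: convex_on_subset[OF phi_convex])
  then show ?thesis
    using assms by (simp add: continuous_on_eq_continuous_at)
qed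

lemma borel_measurable_phi:
  assumes [measurable]: "f \<in> borel_measurable M" and nonneg: "\<And>x. x \<in> space M \<Longrightarrow> 0 \<le> f x"
  shows "(\<lambda>x. \<phi> (f x)) \<in> borel_measurable M"
proof -
  \<comment> \<open>Cutting off negative arguments gives a function that is monotone on the whole
    line, hence Borel.\<close>
  have "mono (\<lambda>x. \<phi> (max 0 x))"
    by (auto simp: mono_def intro!: phi_mono)
  then have [measurable]: "(\<lambda>x. \<phi> (max 0 x)) \<in> borel_measurable borel"
    by (rule borel_measurable_mono)
  have "(\<lambda>x. \<phi> (max 0 (f x))) \<in> borel_measurable M"
    by measurable
  then show ?thesis
    by (rule measurable_cong[THEN iffD1, rotated]) (simp add: nonneg)
qed

lemma borel_measurable_orlicz_term:
  assumes [measurable]: "p \<in> borel_measurable M" "v \<in> borel_measurable M"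
    and nonneg: "\<And>x. x \<in> space M \<Longrightarrow> 0 \<le> v x"
  shows "(\<lambda>x. orlicz_term \<phi> (p x) (v x)) \<in> borel_measurable M"
proof -
  have [measurable]: "(\<lambda>x. \<phi> (enn2real (p x) / v x)) \<in> borel_measurable M"
    using nonneg by (intro borel_measurable_phi) auto
  show ?thesis
    unfolding orlicz_term_def by measurable
qed

lemma orlicz_term_zero [simp]: "orlicz_term \<phi> 0 v = 0"
  by (simp add: orlicz_term_def)

lemma orlicz_term_ennreal: "0 \<le> y \<Longrightarrow> 0 < v \<Longrightarrow> orlicz_term \<phi> (ennreal y) v = ennreal (\<phi> (y / v) * v)"
  by (simp add: orlicz_term_def)

lemma orlicz_term_mono:
  assumes "y \<le> y'" "0 \<le> v"
  shows "orlicz_term \<phi> y v \<le> orlicz_term \<phi> y' v"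
proof -
  have "enn2real y \<le> enn2real y'" if "y' \<noteq> top"
    using that assms by (intro enn2real_mono) (auto simp: less_top)
  then show ?thesis
    using assms by (auto simp: orlicz_term_def top_unique intro!: ennreal_leI mult_right_mono phi_mono divide_right_mono)
qed

text \<open>\<open>\<phi> (z / v) * v\<close> is \<open>z\<close> times the slope of the chord of
  \<open>\<phi>\<close> from 0 to \<open>z / v\<close>, and this slope grows as \<open>v\<close>
  shrinks.\<close>

lemma orlicz_term_antimono:
  assumes "0 \<le> v" "v \<le> v'"
  shows "orlicz_term \<phi> y v' \<le> orlicz_term \<phi> y v"
proof (cases "y = top \<or> y = 0 \<or> v = 0")
  case False
  then have v: "0 < v" and y: "0 < enn2real y"
    using assms by (auto simp: enn2real_positive_iff less_top zero_less_iff_neq_zero)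
  define z where "z = enn2real y"
  have "\<phi> (z / v') / (z / v') \<le> \<phi> (z / v) / (z / v)"
    using phi_slope_mono[of 0 "z / v'" 0 "z / v"] v y assms by (simp add: z_def divide_left_mono)
  then have "\<phi> (z / v') * v' \<le> \<phi> (z / v) * v"
    using y by (simp add: z_def divide_le_cancel)
  then show ?thesis
    using False v assms by (auto simp: orlicz_term_def z_def intro!: ennreal_leI)
qed (use assms in \<open>auto simp: orlicz_term_def\<close>)

text \<open>At \<open>v = 0\<close> and \<open>y > 0\<close> the difference would be
  \<open>\<infinity> - \<infinity>\<close>. The value \<open>\<infinity>\<close> keeps the increment
  decreasing in \<open>v\<close> and reproduces the convention for \<open>v = 0\<close> once
  increments are summed.\<close>

definition orlicz_incr :: "real \<Rightarrow> real \<Rightarrow> real \<Rightarrow> ennreal" where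
  "orlicz_incr y y' v = (if v = 0 then \<infinity> else ennreal (\<phi> (y' / v) * v - \<phi> (y / v) * v))"

text \<open>This is the submodularity. The increment is \<open>y' - y\<close> times the slope of
  \<open>\<phi>\<close> over the interval from \<open>y / v\<close> to \<open>y' / v\<close>, whose
  endpoints both move right as \<open>v\<close> decreases.\<close>

lemma orlicz_incr_antimono:
  assumes "0 \<le> y" "y < y'" "0 \<le> v" "v \<le> v'"
  shows "orlicz_incr y y' v' \<le> orlicz_incr y y' v"
proof (cases "v = 0")
  case False
  then have v: "0 < v" "0 < v'"
    using assms by auto
  have "(\<phi> (y' / v') - \<phi> (y / v')) / (y' / v' - y / v') \<le> (\<phi> (y' / v) - \<phi> (y / v)) / (y' / v - y / v)"
    using v assms by (intro phi_slope_mono) (auto intro!: divide_left_mono divide_strict_right_mono)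
  moreover have "(\<phi> (y' / u) - \<phi> (y / u)) / (y' / u - y / u) = (\<phi> (y' / u) * u - \<phi> (y / u) * u) / (y' - y)"
    if "0 < u" for u
    using that by (simp flip: diff_divide_distrib left_diff_distrib)
  ultimately have "(\<phi> (y' / v') * v' - \<phi> (y / v') * v') / (y' - y) \<le> (\<phi> (y' / v) * v - \<phi> (y / v) * v) / (y' - y)"
    using v by simp
  then show ?thesis
    using v assms by (auto simp: orlicz_incr_def divide_le_cancel intro!: ennreal_leI)
qed (simp add: orlicz_incr_def)

lemma borel_measurable_orlicz_incr:
  assumes "0 \<le> y" "0 \<le> y'" and [measurable]: "v \<in> borel_measurable M"
    and nonneg: "\<And>x. x \<in> space M \<Longrightarrow> 0 \<le> v x"
  shows "(\<lambda>x. orlicz_incr y y' (v x)) \<in> borel_measurable M"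
proof -
  have [measurable]: "(\<lambda>x. \<phi> (z / v x)) \<in> borel_measurable M" if "0 \<le> z" for z
    using nonneg that by (intro borel_measurable_phi) auto
  show ?thesis
    using assms(1,2) unfolding orlicz_incr_def by measurable
qed

lemma sum_orlicz_incr:
  assumes "0 < v" "0 \<le> \<delta>"
  shows "(\<Sum>k<m. orlicz_incr (real k * \<delta>) (real (Suc k) * \<delta>) v) = orlicz_term \<phi> (ennreal (real m * \<delta>)) v"
proof -
  have nonneg: "0 \<le> \<phi> (real (Suc k) * \<delta> / v) * v - \<phi> (real k * \<delta> / v) * v" for k
    using assms by (auto intro!: mult_right_mono phi_mono divide_right_mono)
  have "(\<Sum>k<m. orlicz_incr (real k * \<delta>) (real (Suc k) * \<delta>) v)
      = (\<Sum>k<m. ennreal (\<phi> (real (Suc k) * \<delta> / v) * v - \<phi> (real k * \<delta> / v) * v))"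
    using assms by (simp add: orlicz_incr_def)
  also have "\<dots> = ennreal (\<Sum>k<m. \<phi> (real (Suc k) * \<delta> / v) * v - \<phi> (real k * \<delta> / v) * v)"
    using nonneg by (intro sum_ennreal) auto
  also have "\<dots> = orlicz_term \<phi> (ennreal (real m * \<delta>)) v"
    using assms by (subst sum_lessThan_telescope) (simp add: orlicz_term_ennreal)
  finally show ?thesis .
qed

text \<open>For \<open>v > 0\<close> and \<open>0 < y < \<infinity>\<close>, the value of \<^term>\<open>orlicz_term \<phi>\<close> at the largest multiple of \<open>\<delta>\<close> strictly below \<open>y\<close>,
  written as a sum over the level sets of \<open>y\<close>.\<close>

definition orlicz_step :: "real \<Rightarrow> ennreal \<Rightarrow> real \<Rightarrow> ennreal" where
  "orlicz_step \<delta> y v =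
     (\<Sum>k. if ennreal (real (Suc k) * \<delta>) < y then orlicz_incr (real k * \<delta>) (real (Suc k) * \<delta>) v else 0)"

lemma orlicz_step_le:
  assumes "0 < \<delta>" "0 \<le> v"
  shows "orlicz_step \<delta> y v \<le> orlicz_term \<phi> y v"
proof (cases "y = top \<or> y = 0 \<or> v = 0")
  case False
  then have v: "0 < v" and y: "y < top"
    using assms by (auto simp: less_top)
  show ?thesis
    unfolding orlicz_step_def
  proof (rule suminf_le_const)
    fix n
    obtain K :: nat where K: "enn2real y < real K * \<delta>"
      using reals_Archimedean3[OF assms(1)] by blast
    \<comment> \<open>\<open>m\<close> counts the grid levels strictly below \<open>y\<close>. All
      later terms vanish, so the sum telescopes to the value at \<open>m * \<delta>\<close>, which
      does not exceed \<open>y\<close>.\<close>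
    define m where "m = (LEAST m::nat. y \<le> ennreal (real (Suc m) * \<delta>))"
    have "y = ennreal (enn2real y)"
      using y by (simp add: less_top)
    also have "\<dots> \<le> ennreal (real (Suc K) * \<delta>)"
      using K assms by (intro ennreal_leI) (simp add: distrib_right)
    finally have "y \<le> ennreal (real (Suc K) * \<delta>)" .
    then have m: "y \<le> ennreal (real (Suc m) * \<delta>)"
      unfolding m_def by (rule LeastI)
    have "k < m" if "ennreal (real (Suc k) * \<delta>) < y" for k
    proof (rule ccontr)
      assume "\<not> k < m"
      then have "ennreal (real (Suc m) * \<delta>) \<le> ennreal (real (Suc k) * \<delta>)"
        using assms by (intro ennreal_leI mult_right_mono) auto
      with m that show False
        by simp
    qed
    then have "(\<Sum>k<n. if ennreal (real (Suc k) * \<delta>) < y then orlicz_incr (real k * \<delta>) (real (Suc k) * \<delta>) v else 0)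
      \<le> (\<Sum>k<m. orlicz_incr (real k * \<delta>) (real (Suc k) * \<delta>) v)"
      by (subst sum.mono_neutral_cong_right[of "{..<n}" "{..<n} \<inter> {..<m}"])
        (auto simp: not_less intro!: order.trans[OF sum_mono sum_mono2])
    also have "\<dots> = orlicz_term \<phi> (ennreal (real m * \<delta>)) v"
      using v assms by (intro sum_orlicz_incr) auto
    also have "\<dots> \<le> orlicz_term \<phi> y v"
    proof (rule orlicz_term_mono)
      show "ennreal (real m * \<delta>) \<le> y"
      proof (cases m)
        case (Suc m')
        then have "\<not> y \<le> ennreal (real (Suc m') * \<delta>)"
          unfolding m_def by (metis lessI not_less_Least)
        then show ?thesis
          using Suc by simp
      qed simp
    qed fact
    finally show "(\<Sum>k<n. if ennreal (real (Suc k) * \<delta>) < y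
      then orlicz_incr (real k * \<delta>) (real (Suc k) * \<delta>) v else 0) \<le> orlicz_term \<phi> y v" .
  qed simp
qed (auto simp: orlicz_term_def orlicz_step_def)

lemma orlicz_step_ge:
  assumes "0 < \<delta>" "0 \<le> z" "ennreal (z + \<delta>) < y" "0 < v"
  shows "orlicz_term \<phi> (ennreal z) v \<le> orlicz_step \<delta> y v"
proof -
  \<comment> \<open>\<open>m * \<delta>\<close> is \<open>z\<close> rounded up to the grid. It stays
    below \<open>z + \<delta>\<close>, so the first \<open>m\<close> levels all lie below
    \<open>y\<close> and their increments are present in the step sum.\<close>
  define m where "m = nat \<lceil>z / \<delta>\<rceil>"
  have "z / \<delta> \<le> real m" "real m < z / \<delta> + 1"
    using assms ceiling_correct[of "z / \<delta>"] by (auto simp: m_def)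
  then have m: "z \<le> real m * \<delta>" "real m * \<delta> < z + \<delta>"
    using assms by (auto simp: field_simps)
  have less: "ennreal (real (Suc k) * \<delta>) < y" if "k < m" for k
  proof -
    have "real (Suc k) * \<delta> \<le> real m * \<delta>"
      using assms that by (intro mult_right_mono) auto
    with m have "ennreal (real (Suc k) * \<delta>) \<le> ennreal (z + \<delta>)"
      by (intro ennreal_leI) linarith
    with assms show ?thesis
      by simp
  qed
  have "orlicz_term \<phi> (ennreal z) v \<le> orlicz_term \<phi> (ennreal (real m * \<delta>)) v"
    using assms m by (intro orlicz_term_mono ennreal_leI) auto
  also have "\<dots> = (\<Sum>k<m. orlicz_incr (real k * \<delta>) (real (Suc k) * \<delta>) v)"
    using assms by (subst sum_orlicz_incr) auto
  also have "\<dots> = (\<Sum>k<m. if ennreal (real (Suc k) * \<delta>) < y then orlicz_incr (real k * \<delta>) (real (Suc k) * \<delta>) v else 0)"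
    using less by (intro sum.cong) auto
  also have "\<dots> \<le> orlicz_step \<delta> y v"
    unfolding orlicz_step_def by (rule sum_le_suminf) auto
  finally show ?thesis .
qed

text \<open>The grids of width \<open>1 / Suc n\<close> are not nested, so the step sums need not
  increase with \<open>n\<close>; a bound by the liminf is what Fatou's lemma requires.\<close>

lemma orlicz_term_le_liminf_step:
  assumes "0 \<le> v"
  shows "orlicz_term \<phi> y v \<le> liminf (\<lambda>n. orlicz_step (1 / real (Suc n)) y v)"
proof (cases "y = 0")
  case y: False
  have lim: "(\<lambda>n. z + 1 / real (Suc n)) \<longlonglongrightarrow> z" for z
    using tendsto_add[OF tendsto_const LIMSEQ_inverse_real_of_nat, of z]
    by (simp add: inverse_eq_divide)
  have less: "\<forall>\<^sub>F n in sequentially. ennreal (z + 1 / real (Suc n)) < y" if "ennreal z < y" for z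
    using tendsto_ennrealI[OF lim] that by (rule order_tendstoD)
  have incr_le_step: "orlicz_incr 0 \<delta> v \<le> orlicz_step \<delta> y v" if "ennreal \<delta> < y" for \<delta>
    using that sum_le_suminf[OF summableI, of "{0::nat}" "\<lambda>k. if ennreal (real (Suc k) * \<delta>) < y
      then orlicz_incr (real k * \<delta>) (real (Suc k) * \<delta>) v else 0"]
    by (simp add: orlicz_step_def)
  show ?thesis
  proof (cases "v = 0")
    \<comment> \<open>As soon as one grid level lies below \<open>y\<close>, the very first
      increment is \<open>\<infinity>\<close>.\<close>
    case True
    have "\<forall>\<^sub>F n in sequentially. orlicz_step (1 / real (Suc n)) y v = \<infinity>"
      using less[of 0, simplified ennreal_0, OF y[folded zero_less_iff_neq_zero]]
    proof eventually_elim
      case (elim n)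
      then have "orlicz_incr 0 (1 / real (Suc n)) v \<le> orlicz_step (1 / real (Suc n)) y v"
        by (intro incr_le_step) simp
      then show ?case
        using True by (simp add: orlicz_incr_def top_unique)
    qed
    then have "liminf (\<lambda>n. orlicz_step (1 / real (Suc n)) y v) = \<infinity>"
      by (simp add: tendsto_eventually lim_imp_Liminf)
    then show ?thesis
      by simp
  next
    case False
    with assms have v: "0 < v"
      by simp
    have step: "orlicz_term \<phi> (ennreal z) v \<le> liminf (\<lambda>n. orlicz_step (1 / real (Suc n)) y v)"
      if "0 \<le> z" "ennreal z < y" for z
      using that v by (intro Liminf_bounded eventually_mono[OF less] orlicz_step_ge) auto
    show ?thesis
    proof (cases "y = top")
      case True
      have "ennreal c \<le> liminf (\<lambda>n. orlicz_step (1 / real (Suc n)) y v)" if c: "0 < c" for c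
      proof -
        have pos: "0 < \<phi> 1"
          using phi_less[of 0 1] by simp
        \<comment> \<open>The second entry makes \<open>u * \<phi> 1\<close> at least
          \<open>c / v\<close>; the first makes the superlinear bound applicable.\<close>
        define u where "u = max 1 (c / (v * \<phi> 1))"
        have "c / v \<le> u * \<phi> 1"
          using v pos by (auto simp: u_def field_simps max_def)
        also have "\<dots> \<le> \<phi> u"
          by (rule phi_superlinear) (simp add: u_def)
        finally have "ennreal c \<le> orlicz_term \<phi> (ennreal (u * v)) v"
          using v by (auto simp: orlicz_term_ennreal u_def field_simps intro!: ennreal_leI)
        also have "\<dots> \<le> liminf (\<lambda>n. orlicz_step (1 / real (Suc n)) y v)"
          using True v by (intro step) (auto simp: u_def)
        finally show ?thesis .
      qed
      \<comment> \<open>A finite liminf would dominate a number exceeding it by 1.\<close>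
      from this[of "enn2real (liminf (\<lambda>n. orlicz_step (1 / real (Suc n)) y v)) + 1"]
      have "liminf (\<lambda>n. orlicz_step (1 / real (Suc n)) y v) = top"
        by (cases "liminf (\<lambda>n. orlicz_step (1 / real (Suc n)) y v)") (auto simp: add_pos_nonneg add_nonneg_pos)
      then show ?thesis
        by simp
    next
      case False
      define z where "z = enn2real y"
      have z: "y = ennreal z" "0 < z"
        using False y by (auto simp: z_def enn2real_positive_iff less_top zero_less_iff_neq_zero)
      \<comment> \<open>\<open>step\<close> reaches only values strictly below \<open>y\<close>;
        left-continuity closes the gap.\<close>
      have "((\<lambda>x. \<phi> (x / v)) \<longlongrightarrow> \<phi> (z / v)) (at_left z)"
        using z v by (intro isCont_tendsto_compose[OF isCont_phi] tendsto_intros) auto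
      then have "((\<lambda>x. ennreal (\<phi> (x / v) * v)) \<longlongrightarrow> ennreal (\<phi> (z / v) * v)) (at_left z)"
        by (intro tendsto_intros)
      moreover have "\<forall>\<^sub>F x in at_left z. ennreal (\<phi> (x / v) * v) \<le> liminf (\<lambda>n. orlicz_step (1 / real (Suc n)) y v)"
        using eventually_at_left_real[OF z(2)]
        by eventually_elim (use step v z in \<open>auto simp: orlicz_term_ennreal ennreal_less_iff\<close>)
      ultimately have "ennreal (\<phi> (z / v) * v) \<le> liminf (\<lambda>n. orlicz_step (1 / real (Suc n)) y v)"
        by (rule tendsto_upperbound) simp
      then show ?thesis
        using z v by (simp add: orlicz_term_ennreal)
    qed
  qed
qed simp

end

subsection \<open>Comparison through level sets\<close>

lemma emeasure_lborel_atLeast: "emeasure lborel {x::real..} = \<infinity>"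
proof (rule ccontr)
  assume "emeasure lborel {x..} \<noteq> \<infinity>"
  then obtain r where r: "emeasure lborel {x..} = ennreal r" "0 \<le> r"
    by (cases "emeasure lborel {x..}") auto
  have "emeasure lborel {x..x + r + 1} \<le> emeasure lborel {x..}"
    by (intro emeasure_mono) auto
  with r show False
    by simp
qed

text \<open>Tonelli on the region under the graph of \<open>g\<close>: the section over
  \<open>x\<close> is the interval from 0 to \<open>g x\<close>, of length \<open>g x\<close> also
  when this is infinite.\<close>

lemma nn_integral_layer_cake:
  assumes "sigma_finite_measure M" and [measurable]: "g \<in> borel_measurable M"
  shows "(\<integral>\<^sup>+ x. g x \<partial>M) =
    (\<integral>\<^sup>+ u. (if 0 \<le> u then emeasure M {x \<in> space M. ennreal u < g x} else 0) \<partial>lborel)"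
proof -
  interpret M: sigma_finite_measure M by fact
  interpret pair_sigma_finite M lborel ..
  have layer: "(\<integral>\<^sup>+ u. (if 0 \<le> u \<and> ennreal u < y then 1 else 0) \<partial>lborel) = y" for y
  proof (cases y)
    case (real r)
    have "(\<integral>\<^sup>+ u. (if 0 \<le> u \<and> ennreal u < y then 1 else 0) \<partial>lborel) = (\<integral>\<^sup>+ u. indicator {0..<r} u \<partial>lborel)"
      using real by (intro nn_integral_cong) (auto simp: ennreal_less_iff)
    then show ?thesis
      using real by simp
  next
    case top
    have "(\<integral>\<^sup>+ u. (if 0 \<le> u \<and> ennreal u < y then 1 else 0) \<partial>lborel) = (\<integral>\<^sup>+ u. indicator {0::real..} u \<partial>lborel)"
      using top by (intro nn_integral_cong) auto
    also have "\<dots> = emeasure lborel {0::real..}"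
      by simp
    also have "\<dots> = \<infinity>"
      by (rule emeasure_lborel_atLeast)
    finally show ?thesis
      using top by simp
  qed
  have "(\<integral>\<^sup>+ x. g x \<partial>M) = (\<integral>\<^sup>+ x. (\<integral>\<^sup>+ u. (if 0 \<le> u \<and> ennreal u < g x then 1 else 0) \<partial>lborel) \<partial>M)"
    by (simp only: layer)
  also have "\<dots> = (\<integral>\<^sup>+ u. (\<integral>\<^sup>+ x. (if 0 \<le> u \<and> ennreal u < g x then 1 else 0) \<partial>M) \<partial>lborel)"
    by (rule Fubini'[symmetric]) measurable
  also have "\<dots> = (\<integral>\<^sup>+ u. (if 0 \<le> u then emeasure M {x \<in> space M. ennreal u < g x} else 0) \<partial>lborel)"
  proof (intro nn_integral_cong)
    fix u :: real
    have "(\<integral>\<^sup>+ x. (if 0 \<le> u \<and> ennreal u < g x then 1 else 0) \<partial>M) =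
      (\<integral>\<^sup>+ x. indicator {x \<in> space M. 0 \<le> u \<and> ennreal u < g x} x \<partial>M)"
      by (intro nn_integral_cong) auto
    then show "(\<integral>\<^sup>+ x. (if 0 \<le> u \<and> ennreal u < g x then 1 else 0) \<partial>M) =
      (if 0 \<le> u then emeasure M {x \<in> space M. ennreal u < g x} else 0)"
      by simp
  qed
  finally show ?thesis .
qed

lemma nn_integral_le_if_level_sets_le:
  assumes "sigma_finite_measure M" "g \<in> borel_measurable M" "h \<in> borel_measurable M"
    and "\<And>u. emeasure M {x \<in> space M. u < g x} \<le> emeasure M {x \<in> space M. u < h x}"
  shows "(\<integral>\<^sup>+ x. g x \<partial>M) \<le> (\<integral>\<^sup>+ x. h x \<partial>M)"
  using assms by (auto simp: nn_integral_layer_cake intro!: nn_integral_mono)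

text \<open>To be read with \<open>P\<close> = {f* > s}, \<open>Q\<close> = {w not in D},
  \<open>A\<close> = {|f| > s}, \<open>E\<close> = {v not in D}. Nesting makes the left side exactly
  |P| - |Q| or 0, whereas |A| - |E| is merely a lower bound for the right side. The assumption on
  infinite \<open>Q\<close> keeps the subtraction meaningful.\<close>

lemma emeasure_Diff_nested_le:
  assumes [measurable]: "P \<in> sets M" "Q \<in> sets M" "A \<in> sets M" "E \<in> sets M"
    and nested: "P \<subseteq> Q \<or> Q \<subseteq> P" and inf: "emeasure M Q = \<infinity> \<Longrightarrow> P \<subseteq> Q"
    and le: "emeasure M P \<le> emeasure M A" "emeasure M E \<le> emeasure M Q"
  shows "emeasure M (P - Q) \<le> emeasure M (A - E)"
proof (cases "P \<subseteq> Q")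
  case True
  then show ?thesis
    by (simp add: Diff_eq_empty_iff[THEN iffD2])
next
  case False
  with nested inf have Q: "Q \<subseteq> P" "emeasure M Q \<noteq> \<infinity>"
    by auto
  have "emeasure M A \<le> emeasure M ((A - E) \<union> E)"
    by (intro emeasure_mono) auto
  also have "\<dots> \<le> emeasure M (A - E) + emeasure M E"
    by (intro emeasure_subadditive; measurable)
  finally have A: "emeasure M A \<le> emeasure M (A - E) + emeasure M E" .
  have E: "emeasure M E \<noteq> top"
    using Q le by (auto simp: top_unique)
  have "emeasure M (P - Q) = emeasure M P - emeasure M Q"
    using Q by (intro emeasure_Diff) auto
  also have "\<dots> \<le> emeasure M A - emeasure M E"
    using le by (intro ennreal_minus_mono)
  also have "\<dots> \<le> emeasure M (A - E)"
    using A E by (simp add: ennreal_minus_le_iff add.commute)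
  finally show ?thesis .
qed

context orlicz
begin

text \<open>Shared by functions and sequences. Increments decrease in \<open>v\<close>, so their
  superlevel sets are down-sets and \<open>level\<close> compares them; the layer-cake formula
  integrates the comparison, and summation over the grid followed by refinement does the
  rest.\<close>

lemma nn_integral_orlicz_term_le:
  assumes M: "sigma_finite_measure M"
    and [measurable]: "p \<in> borel_measurable M" "p' \<in> borel_measurable M"
      "v \<in> borel_measurable M" "w \<in> borel_measurable M"
    and v: "\<And>x. x \<in> space M \<Longrightarrow> 0 \<le> v x" and w: "\<And>x. x \<in> space M \<Longrightarrow> 0 \<le> w x"
    and level: "\<And>s D. 0 \<le> s \<Longrightarrow> (\<And>x y. y \<in> D \<Longrightarrow> 0 \<le> x \<Longrightarrow> x \<le> y \<Longrightarrow> x \<in> D) \<Longrightarrow>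
      {x \<in> space M. v x \<in> D} \<in> sets M \<Longrightarrow> {x \<in> space M. w x \<in> D} \<in> sets M \<Longrightarrow>
      emeasure M {x \<in> space M. ennreal s < p' x \<and> w x \<in> D} \<le> emeasure M {x \<in> space M. ennreal s < p x \<and> v x \<in> D}"
  shows "(\<integral>\<^sup>+ x. orlicz_term \<phi> (p' x) (w x) \<partial>M) \<le> (\<integral>\<^sup>+ x. orlicz_term \<phi> (p x) (v x) \<partial>M)"
proof -
  note [measurable] = borel_measurable_orlicz_incr[OF _ _ _ v] borel_measurable_orlicz_incr[OF _ _ _ w]
  have step_measurable: "(\<lambda>x. orlicz_step \<delta> (q x) (u x)) \<in> borel_measurable M"
    if "0 < \<delta>" and [measurable]: "q \<in> borel_measurable M" "u \<in> borel_measurable M"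
      and u: "\<And>x. x \<in> space M \<Longrightarrow> 0 \<le> u x" for \<delta> q u
    unfolding orlicz_step_def using \<open>0 < \<delta>\<close> borel_measurable_orlicz_incr[OF _ _ _ u, measurable] by simp
  have step: "(\<integral>\<^sup>+ x. orlicz_step \<delta> (p' x) (w x) \<partial>M) \<le> (\<integral>\<^sup>+ x. orlicz_step \<delta> (p x) (v x) \<partial>M)"
    if \<delta>: "0 < \<delta>" for \<delta>
  proof -
    have "(\<integral>\<^sup>+ x. (if ennreal (real (Suc k) * \<delta>) < p' x then orlicz_incr (real k * \<delta>) (real (Suc k) * \<delta>) (w x) else 0) \<partial>M)
      \<le> (\<integral>\<^sup>+ x. (if ennreal (real (Suc k) * \<delta>) < p x then orlicz_incr (real k * \<delta>) (real (Suc k) * \<delta>) (v x) else 0) \<partial>M)" for k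
    proof -
      let ?s = "real (Suc k) * \<delta>" and ?h = "orlicz_incr (real k * \<delta>) (real (Suc k) * \<delta>)"
      have meas: "(\<lambda>x. ?h (v x)) \<in> borel_measurable M" "(\<lambda>x. ?h (w x)) \<in> borel_measurable M"
        using \<delta> v w by (auto intro!: borel_measurable_orlicz_incr)
      note [measurable] = meas
      show ?thesis
      proof (intro nn_integral_le_if_level_sets_le M)
        fix u
        let ?D = "{y. u < ?h y}"
        have "emeasure M {x \<in> space M. ennreal ?s < p' x \<and> w x \<in> ?D} \<le> emeasure M {x \<in> space M. ennreal ?s < p x \<and> v x \<in> ?D}"
        proof (rule level)
          show "x \<in> ?D" if "y \<in> ?D" "0 \<le> x" "x \<le> y" for x y
            using that \<delta> orlicz_incr_antimono[of "real k * \<delta>" ?s x y] by (auto intro: less_le_trans)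
        qed (use \<delta> in auto)
        moreover have "{x \<in> space M. u < (if ennreal ?s < q x then ?h (y x) else 0)} = {x \<in> space M. ennreal ?s < q x \<and> y x \<in> ?D}"
          for q y by auto
        ultimately show "emeasure M {x \<in> space M. u < (if ennreal ?s < p' x then ?h (w x) else 0)}
          \<le> emeasure M {x \<in> space M. u < (if ennreal ?s < p x then ?h (v x) else 0)}"
          by simp
      qed measurable
    qed
    then show ?thesis
      unfolding orlicz_step_def using \<delta> borel_measurable_orlicz_incr v w
      by (subst (1 2) nn_integral_suminf) (auto intro!: suminf_le)
  qed
  \<comment> \<open>Convergence is needed only on the side of \<open>w\<close>, by Fatou; on the
    side of \<open>v\<close> every step sum already lies below its limit.\<close>
  have "(\<integral>\<^sup>+ x. orlicz_term \<phi> (p' x) (w x) \<partial>M) \<le> (\<integral>\<^sup>+ x. liminf (\<lambda>n. orlicz_step (1 / real (Suc n)) (p' x) (w x)) \<partial>M)"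
    using w by (intro nn_integral_mono orlicz_term_le_liminf_step)
  also have "\<dots> \<le> liminf (\<lambda>n. \<integral>\<^sup>+ x. orlicz_step (1 / real (Suc n)) (p' x) (w x) \<partial>M)"
    using w by (intro nn_integral_liminf step_measurable) auto
  also have "\<dots> \<le> liminf (\<lambda>n. \<integral>\<^sup>+ x. orlicz_step (1 / real (Suc n)) (p x) (v x) \<partial>M)"
    by (intro Liminf_mono always_eventually allI step) simp
  also have "\<dots> \<le> liminf (\<lambda>n. \<integral>\<^sup>+ x. orlicz_term \<phi> (p x) (v x) \<partial>M)"
    using v by (intro Liminf_mono always_eventually allI nn_integral_mono orlicz_step_le) auto
  finally show ?thesis
    by (simp add: Liminf_const)
qed

end

subsection \<open>Decreasing rearrangements of functions\<close>

text \<open>Right-continuity of \<open>d\<close> is what makes the equivalence exact.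
  \<open>Z\<close> is fixed only up to the point 0 because the rearrangement of a function admits
  the level 0 and that of a sequence does not.\<close>

lemma Inf_ennreal_image_le_iff:
  fixes d :: "real \<Rightarrow> ennreal"
  assumes antimono: "\<And>r r'. r \<le> r' \<Longrightarrow> d r' \<le> d r"
    and right_cont: "(\<And>r. s < r \<Longrightarrow> d r \<le> c) \<Longrightarrow> d s \<le> c"
    and Z: "{r. 0 < r \<and> d r \<le> c} \<subseteq> Z" "Z \<subseteq> {r. 0 \<le> r \<and> d r \<le> c}" and "0 \<le> s"
  shows "Inf (ennreal ` Z) \<le> ennreal s \<longleftrightarrow> d s \<le> c"
proof
  assume le: "Inf (ennreal ` Z) \<le> ennreal s"
  show "d s \<le> c"
  proof (rule right_cont)
    fix r assume "s < r"
    with le \<open>0 \<le> s\<close> have "Inf (ennreal ` Z) < ennreal r"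
      by (auto intro: le_less_trans simp: ennreal_less_iff)
    then obtain z where "z \<in> Z" "ennreal z < ennreal r"
      by (auto simp: Inf_less_iff)
    then have "d z \<le> c" "z \<le> r"
      using Z \<open>0 \<le> s\<close> \<open>s < r\<close> by (auto simp: ennreal_less_iff less_imp_le)
    then show "d r \<le> c"
      using antimono order.trans by blast
  qed
next
  assume d: "d s \<le> c"
  show "Inf (ennreal ` Z) \<le> ennreal s"
  \<comment> \<open>\<open>s\<close> itself may be missing from \<open>Z\<close> when
    \<open>s = 0\<close>; every \<open>s + e\<close> belongs to it.\<close>
  proof (rule ennreal_le_epsilon)
    fix e :: real assume e: "0 < e"
    then have "d (s + e) \<le> c"
      using d antimono[of s "s + e"] by (auto intro: order.trans)
    then have "s + e \<in> Z"
      using Z e \<open>0 \<le> s\<close> by auto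
    then have "Inf (ennreal ` Z) \<le> ennreal (s + e)"
      by (intro Inf_lower) auto
    then show "Inf (ennreal ` Z) \<le> ennreal s + ennreal e"
      using e \<open>0 \<le> s\<close> by simp
  qed
qed

text \<open>Continuity from below along the levels \<open>s + 1 / Suc n\<close>, which is valid for
  infinite measures too.\<close>

lemma emeasure_level_right_cont:
  fixes g :: "'a \<Rightarrow> real"
  assumes [measurable]: "g \<in> borel_measurable M"
    and le: "\<And>r. s < r \<Longrightarrow> emeasure M {x \<in> space M. r < g x} \<le> c"
  shows "emeasure M {x \<in> space M. s < g x} \<le> c"
proof -
  let ?A = "\<lambda>n. {x \<in> space M. s + 1 / real (Suc n) < g x}"
  have "{x \<in> space M. s < g x} = (\<Union>n. ?A n)"
  proof safe
    fix x assume "x \<in> space M" "s < g x"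
    then obtain n where "inverse (real (Suc n)) < g x - s"
      using reals_Archimedean[of "g x - s"] by auto
    then show "x \<in> (\<Union>n. ?A n)"
      using \<open>x \<in> space M\<close> by (auto simp: inverse_eq_divide intro!: exI[of _ n])
  next
    fix x n assume "s + 1 / real (Suc n) < g x"
    moreover have "0 < 1 / real (Suc n)"
      by simp
    ultimately show "s < g x"
      by linarith
  qed
  moreover have "incseq ?A"
    by (intro incseq_SucI) (auto intro: le_less_trans[rotated] simp: frac_le)
  ultimately have "emeasure M {x \<in> space M. s < g x} = (SUP n. emeasure M (?A n))"
    by (subst SUP_emeasure_incseq) auto
  also have "\<dots> \<le> c"
    by (intro SUP_least le) simp
  finally show ?thesis .
qed

lemma sigma_finite_lebesgue_on:
  assumes "S \<in> sets lebesgue"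
  shows "sigma_finite_measure (lebesgue_on S)"
proof (rule sigma_finite_measure_restrict_space[OF _ assms])
  show "sigma_finite_measure (lebesgue :: 'a measure)"
  proof
    show "\<exists>A. countable A \<and> A \<subseteq> sets lebesgue \<and> \<Union> A = space lebesgue \<and> (\<forall>a\<in>A. emeasure (lebesgue :: 'a measure) a \<noteq> \<infinity>)"
    proof (intro exI conjI ballI)
      show "\<Union> (range (\<lambda>n::nat. ball 0 (real n))) = space (lebesgue :: 'a measure)"
        using reals_Archimedean2 by (auto simp: mem_ball)
      show "emeasure lebesgue A \<noteq> \<infinity>" if "A \<in> range (\<lambda>n::nat. ball (0::'a) (real n))" for A
      proof -
        from that obtain n :: nat where "A = ball 0 (real n)"
          by blast
        then show ?thesis
          using emeasure_lborel_ball_finite[of "0::'a" "real n"] by simp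
      qed
    qed auto
  qed
qed

lemma emeasure_lebesgue_initial_le:
  assumes "S \<subseteq> {0<..}" "0 \<le> r" "\<And>x. x \<in> S \<Longrightarrow> x \<le> r"
  shows "emeasure lebesgue S \<le> ennreal r"
proof -
  have "emeasure lebesgue S \<le> emeasure lebesgue {0..r}"
    using assms by (intro emeasure_mono) (auto simp: less_imp_le)
  then show ?thesis
    using assms by simp
qed

lemma emeasure_lebesgue_initial_ge:
  assumes "S \<in> sets lebesgue" "{0<..<r} \<subseteq> S"
  shows "ennreal r \<le> emeasure lebesgue S"
proof (cases "0 \<le> r")
  case True
  have "emeasure lebesgue {0<..<r} \<le> emeasure lebesgue S"
    using assms by (intro emeasure_mono) auto
  then show ?thesis
    using True by simp
qed (simp add: ennreal_neg)

context
  fixes a :: ereal and I :: "real set"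
  assumes I: "I = einterval 0 a"
begin

lemma mem_interval_iff: "t \<in> I \<longleftrightarrow> 0 < t \<and> ereal t < a"
  by (simp add: I einterval_def zero_ereal_def)

lemma sets_interval [measurable]: "I \<in> sets borel" "I \<in> sets lebesgue"
  by (simp_all add: I)

lemma mem_interval_of_less_emeasure:
  assumes "0 < r" "ennreal r < emeasure lebesgue I"
  shows "r \<in> I"
proof (rule ccontr)
  assume "r \<notin> I"
  then have "a \<le> ereal r"
    using assms by (simp add: mem_interval_iff)
  then have "t \<le> r" if "t \<in> I" for t
    using that by (auto simp: mem_interval_iff dest: less_le_trans)
  then have "emeasure lebesgue I \<le> ennreal r"
    using assms by (intro emeasure_lebesgue_initial_le) (auto simp: mem_interval_iff)
  with assms show False
    by simp
qed

context
  fixes f :: "real \<Rightarrow> real"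
  assumes f: "f \<in> L0 I"
begin

lemma sets_level [measurable]: "{t \<in> I. s < \<bar>f t\<bar>} \<in> sets lebesgue"
proof -
  have [measurable]: "f \<in> borel_measurable (lebesgue_on I)"
    using f by (simp add: L0_def)
  have "{t \<in> space (lebesgue_on I). s < \<bar>f t\<bar>} \<in> sets (lebesgue_on I)"
    by measurable
  then show ?thesis
    by (simp add: sets_restrict_space_iff)
qed

lemma distr_fun_antimono: "s \<le> s' \<Longrightarrow> distr_fun I f s' \<le> distr_fun I f s"
  unfolding distr_fun_def by (intro emeasure_mono) auto

lemma rearr_fun_le_iff:
  assumes "0 \<le> s"
  shows "rearr_fun I f t \<le> ennreal s \<longleftrightarrow> distr_fun I f s \<le> ennreal t"
proof -
  have right_cont: "distr_fun I f s \<le> c" if "\<And>r. s < r \<Longrightarrow> distr_fun I f r \<le> c" for c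
    using that emeasure_level_right_cont[of "\<lambda>t. \<bar>f t\<bar>" "lebesgue_on I" s c] f
    by (simp add: distr_fun_def L0_def emeasure_restrict_space)
  have "rearr_fun I f t = Inf (ennreal ` {r. 0 \<le> r \<and> distr_fun I f r \<le> ennreal t})"
    by (simp add: rearr_fun_def image_Collect)
  then show ?thesis
    using assms by (simp only:) (rule Inf_ennreal_image_le_iff, auto intro: distr_fun_antimono right_cont)
qed

text \<open>Exhibits {f* > s} as an initial segment cut at \<open>distr_fun I f s\<close>; the
  measurability of f* and the nesting both come from this.\<close>

lemma less_rearr_fun_iff: "0 \<le> s \<Longrightarrow> ennreal s < rearr_fun I f t \<longleftrightarrow> ennreal t < distr_fun I f s"
  using rearr_fun_le_iff[of s t] by (simp flip: not_le)

lemma borel_measurable_rearr_fun: "rearr_fun I f \<in> borel_measurable borel"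
proof (rule borel_measurableI_greater)
  fix y
  show "{t \<in> space borel. y < rearr_fun I f t} \<in> sets borel"
    by (cases y) (simp_all add: less_rearr_fun_iff)
qed

end

text \<open>The bound v* \<le> w is used at a single point. If the claim failed, some
  \<open>r\<close> would lie strictly between the two measures; the initial segment {w not in D} is
  then too short to contain \<open>r\<close>, so \<open>w r \<in> D\<close>. Hence \<open>v\<close>
  outside \<open>D\<close> means \<open>v > w r\<close>, and this happens on measure at most
  \<open>r\<close>.\<close>

lemma emeasure_le_of_rearr_fun_le:
  assumes v: "v \<in> L0 I" and le: "\<And>t. t \<in> I \<Longrightarrow> rearr_fun I v t \<le> ennreal (w t)"
    and w: "\<And>t. t \<in> I \<Longrightarrow> 0 \<le> w t" "antimono_on I w"
    and D: "\<And>x y. y \<in> D \<Longrightarrow> 0 \<le> x \<Longrightarrow> x \<le> y \<Longrightarrow> x \<in> D"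
    and [measurable]: "{t \<in> I. w t \<notin> D} \<in> sets lebesgue" "{t \<in> I. \<bar>v t\<bar> \<notin> D} \<in> sets lebesgue"
  shows "emeasure lebesgue {t \<in> I. \<bar>v t\<bar> \<notin> D} \<le> emeasure lebesgue {t \<in> I. w t \<notin> D}"
proof (rule ccontr)
  assume "\<not> ?thesis"
  then have "emeasure lebesgue {t \<in> I. w t \<notin> D} < emeasure lebesgue {t \<in> I. \<bar>v t\<bar> \<notin> D}"
    by simp
  then obtain c where c: "emeasure lebesgue {t \<in> I. w t \<notin> D} < c" "c < emeasure lebesgue {t \<in> I. \<bar>v t\<bar> \<notin> D}"
    using dense by blast
  then obtain r where r: "c = ennreal r" "0 < r"
    by (cases c) (auto simp: order.order_iff_strict)
  have "emeasure lebesgue {t \<in> I. \<bar>v t\<bar> \<notin> D} \<le> emeasure lebesgue I"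
    by (intro emeasure_mono) auto
  with c r have "r \<in> I"
    by (intro mem_interval_of_less_emeasure) auto
  have "w r \<in> D"
  proof (rule ccontr)
    assume "w r \<notin> D"
    have "{0<..<r} \<subseteq> {t \<in> I. w t \<notin> D}"
    proof
      fix t assume t: "t \<in> {0<..<r}"
      with \<open>r \<in> I\<close> have "t \<in> I"
        by (auto simp: mem_interval_iff intro: less_trans[of "ereal t" "ereal r"])
      moreover have "w r \<le> w t"
        using w(2) t \<open>t \<in> I\<close> \<open>r \<in> I\<close> by (auto simp: monotone_on_def)
      then have "w t \<notin> D"
        using D[of "w t" "w r"] w(1)[OF \<open>r \<in> I\<close>] \<open>w r \<notin> D\<close> by blast
      ultimately show "t \<in> {t \<in> I. w t \<notin> D}"
        by simp
    qed
    then have "ennreal r \<le> emeasure lebesgue {t \<in> I. w t \<notin> D}"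
      by (intro emeasure_lebesgue_initial_ge) auto
    with c r show False
      by simp
  qed
  have "emeasure lebesgue {t \<in> I. \<bar>v t\<bar> \<notin> D} \<le> distr_fun I v (w r)"
    unfolding distr_fun_def
  proof (rule emeasure_mono)
    show "{t \<in> I. \<bar>v t\<bar> \<notin> D} \<subseteq> {t \<in> I. w r < \<bar>v t\<bar>}"
      using D[OF \<open>w r \<in> D\<close>] by (auto simp flip: not_le)
  qed (rule sets_level[OF v])
  also have "\<dots> \<le> ennreal r"
    using le[OF \<open>r \<in> I\<close>] rearr_fun_le_iff[OF v] w(1)[OF \<open>r \<in> I\<close>] by blast
  finally show False
    using c r by simp
qed

end

lemma (in orlicz) nn_integral_orlicz_term_rearr_fun_le:
  assumes I: "I = einterval 0 a" and w: "weight_function I w" and f: "f \<in> L0 I" and v: "v \<in> L0 I" "\<And>t. t \<in> I \<Longrightarrow> 0 \<le> v t"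
    and le: "\<And>t. t \<in> I \<Longrightarrow> rearr_fun I v t \<le> ennreal (w t)"
  shows "(\<integral>\<^sup>+ t. orlicz_term \<phi> (rearr_fun I f t) (w t) \<partial>lebesgue_on I)
    \<le> (\<integral>\<^sup>+ t. orlicz_term \<phi> (ennreal \<bar>f t\<bar>) (v t) \<partial>lebesgue_on I)"
proof (rule nn_integral_orlicz_term_le)
  note [measurable] = sets_interval[OF I]
  have w': "w \<in> borel_measurable (lebesgue_on I)" "\<And>t. t \<in> I \<Longrightarrow> 0 \<le> w t" "antimono_on I w"
    using w by (auto simp: weight_function_def)
  show "sigma_finite_measure (lebesgue_on I)"
    by (intro sigma_finite_lebesgue_on) measurable
  have [measurable]: "f \<in> borel_measurable (lebesgue_on I)" "v \<in> borel_measurable (lebesgue_on I)"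
    using f v by (simp_all add: L0_def)
  show "rearr_fun I f \<in> borel_measurable (lebesgue_on I)"
    using borel_measurable_rearr_fun[OF I f] by (intro measurable_restrict_space1 measurable_completion) simp
  show "(\<lambda>t. ennreal \<bar>f t\<bar>) \<in> borel_measurable (lebesgue_on I)" "v \<in> borel_measurable (lebesgue_on I)"
    by measurable
  fix s :: real and D
  assume s: "0 \<le> s" and D: "\<And>x y. y \<in> D \<Longrightarrow> 0 \<le> x \<Longrightarrow> x \<le> y \<Longrightarrow> x \<in> (D :: real set)"
    and "{x \<in> space (lebesgue_on I). v x \<in> D} \<in> sets (lebesgue_on I)"
      "{x \<in> space (lebesgue_on I). w x \<in> D} \<in> sets (lebesgue_on I)"
  then have sets: "{t \<in> I. v t \<in> D} \<in> sets lebesgue" "{t \<in> I. w t \<in> D} \<in> sets lebesgue"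
    by (simp_all add: sets_restrict_space_iff)
  have "I - {t \<in> I. v t \<in> D} \<in> sets lebesgue" "I - {t \<in> I. w t \<in> D} \<in> sets lebesgue"
    using sets by (auto intro!: sets.Diff)
  then have sets': "{t \<in> I. v t \<notin> D} \<in> sets lebesgue" "{t \<in> I. w t \<notin> D} \<in> sets lebesgue"
    by (simp_all add: set_diff_eq conj_disj_distribL Collect_conj_eq cong: conj_cong)
  let ?P = "{t \<in> I. ennreal t < distr_fun I f s}"
  let ?Q = "{t \<in> I. w t \<notin> D}"
  let ?A = "{t \<in> I. s < \<bar>f t\<bar>}"
  let ?E = "{t \<in> I. v t \<notin> D}"
  have Q_initial: "t' \<in> ?Q" if "t \<in> ?Q" "t' \<in> I" "t' \<le> t" for t t'
    using that D[of "w t'" "w t"] w'(2,3) by (auto simp: monotone_on_def)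
  have P_initial: "t' \<in> ?P" if "t \<in> ?P" "t' \<in> I" "t' \<le> t" for t t'
    using that by (auto intro: le_less_trans ennreal_leI)
  have "emeasure lebesgue (?P - ?Q) \<le> emeasure lebesgue (?A - ?E)"
  proof (rule emeasure_Diff_nested_le)
    have "?P \<in> sets borel"
      by measurable
    then show "?P \<in> sets lebesgue"
      by simp
    show "?P \<subseteq> ?Q \<or> ?Q \<subseteq> ?P"
    proof (rule disjCI, rule subsetI)
      fix t assume "\<not> ?Q \<subseteq> ?P" "t \<in> ?P"
      then obtain t' where "t' \<in> ?Q" "t' \<notin> ?P"
        by blast
      then have "t \<le> t'"
        using P_initial[OF \<open>t \<in> ?P\<close>, of t'] by fastforce
      then show "t \<in> ?Q"
        using Q_initial[OF \<open>t' \<in> ?Q\<close>] \<open>t \<in> ?P\<close> by simp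
    qed
    \<comment> \<open>An initial segment that misses a point \<open>t\<close> has measure at most
      \<open>t\<close>.\<close>
    show "?P \<subseteq> ?Q" if inf: "emeasure lebesgue ?Q = \<infinity>"
    proof
      fix t assume "t \<in> ?P"
      show "t \<in> ?Q"
      proof (rule ccontr)
        assume "t \<notin> ?Q"
        then have "t' \<le> t" if "t' \<in> ?Q" for t'
          using Q_initial[OF that] \<open>t \<in> ?P\<close> by fastforce
        then have "emeasure lebesgue ?Q \<le> ennreal t"
          using \<open>t \<in> ?P\<close> by (intro emeasure_lebesgue_initial_le) (auto simp: mem_interval_iff[OF I])
        with inf show False
          by (simp add: top_unique)
      qed
    qed
    show "emeasure lebesgue ?P \<le> emeasure lebesgue ?A"
    proof (cases "distr_fun I f s")
      case (real r)
      then have "emeasure lebesgue ?P \<le> ennreal r"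
        by (intro emeasure_lebesgue_initial_le) (auto simp: mem_interval_iff[OF I] ennreal_less_iff)
      then show ?thesis
        using real by (simp add: distr_fun_def)
    qed (simp add: distr_fun_def)
    have *: "{t \<in> I. \<bar>v t\<bar> \<notin> D} = ?E"
      using v by auto
    show "emeasure lebesgue ?E \<le> emeasure lebesgue ?Q"
      using emeasure_le_of_rearr_fun_le[OF I v(1) le w'(2,3) D] sets' by (simp add: *)
  qed (use sets' sets_level[OF I f] in auto)
  moreover have "?P - ?Q = {t \<in> I. ennreal s < rearr_fun I f t \<and> w t \<in> D}"
    "?A - ?E = {t \<in> I. ennreal s < ennreal \<bar>f t\<bar> \<and> v t \<in> D}"
    using s by (auto simp: less_rearr_fun_iff[OF I f] ennreal_less_iff)
  ultimately show "emeasure (lebesgue_on I) {x \<in> space (lebesgue_on I). ennreal s < rearr_fun I f x \<and> w x \<in> D}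
    \<le> emeasure (lebesgue_on I) {x \<in> space (lebesgue_on I). ennreal s < ennreal \<bar>f x\<bar> \<and> v x \<in> D}"
    by (simp add: emeasure_restrict_space)
qed (use w v in \<open>auto simp: weight_function_def\<close>)

subsection \<open>Measure-preserving ranking\<close>

text \<open>The measure of \<open>L\<close> to the left of \<open>c\<close> is 1-Lipschitz in
  \<open>c\<close>, so intermediate values are attained. The cut is an extended real because the
  whole of an unbounded \<open>L\<close> may be wanted.\<close>

lemma exists_initial_segment_measure_eq:
  assumes L: "L \<in> lmeasurable" "L \<subseteq> {0<..}" and \<beta>: "0 \<le> \<beta>" "ennreal \<beta> \<le> emeasure lebesgue L"
  obtains c :: ereal where "emeasure lebesgue {t \<in> L. ereal t < c} = ennreal \<beta>"
proof (cases "ennreal \<beta> = emeasure lebesgue L")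
  case True
  then have "emeasure lebesgue {t \<in> L. ereal t < \<infinity>} = ennreal \<beta>"
    by simp
  then show ?thesis
    by (rule that)
next
  case False
  with \<beta> have less: "ennreal \<beta> < emeasure lebesgue L"
    by simp
  define g where "g c = measure lebesgue (L \<inter> {..<c})" for c
  have lm: "L \<inter> {..<c} \<in> lmeasurable" for c :: real
    using L by (intro fmeasurable_Int_fmeasurable) auto
  have le: "g c \<le> g c'" "g c' \<le> g c + (c' - c)" if "c \<le> c'" for c c'
  proof -
    show "g c \<le> g c'"
      unfolding g_def using that lm by (intro measure_mono_fmeasurable) auto
    have "g c' \<le> measure lebesgue ((L \<inter> {..<c}) \<union> {c..c'})"
      unfolding g_def using lm by (intro measure_mono_fmeasurable) auto
    also have "\<dots> \<le> g c + measure lebesgue {c..c'}"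
      unfolding g_def using lm by (intro measure_Un_le) auto
    finally show "g c' \<le> g c + (c' - c)"
      using that by simp
  qed
  have "1-lipschitz_on UNIV g"
  proof (rule lipschitz_onI)
    show "dist (g x) (g y) \<le> 1 * dist x y" for x y
      using le[of x y] le[of y x] by (cases "x \<le> y") (auto simp: dist_real_def)
  qed simp
  then have cont: "continuous_on A g" for A
    using lipschitz_on_continuous_on continuous_on_subset by blast
  have "(SUP n::nat. emeasure lebesgue (L \<inter> {..<real n})) = emeasure lebesgue (\<Union>n::nat. L \<inter> {..<real n})"
    using lm by (intro SUP_emeasure_incseq) (auto simp: incseq_def fmeasurableD)
  also have "(\<Union>n::nat. L \<inter> {..<real n}) = L"
    using reals_Archimedean2 by auto
  finally have "ennreal \<beta> < (SUP n::nat. emeasure lebesgue (L \<inter> {..<real n}))"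
    using less by simp
  then obtain n :: nat where "ennreal \<beta> < emeasure lebesgue (L \<inter> {..<real n})"
    by (auto simp: less_SUP_iff)
  then have "\<beta> < g (real n)"
    using lm \<beta> by (simp add: g_def emeasure_eq_measure2 ennreal_less_iff)
  moreover have "g 0 = 0"
  proof -
    have "L \<inter> {..<0} = {}"
      using L by auto
    then show ?thesis
      by (simp add: g_def)
  qed
  ultimately obtain c where "g c = \<beta>"
    using IVT'[of g 0 \<beta> "real n"] cont \<beta> by auto
  moreover have "{t \<in> L. ereal t < ereal c} = L \<inter> {..<c}"
    by auto
  ultimately have "emeasure lebesgue {t \<in> L. ereal t < ereal c} = ennreal \<beta>"
    using lm by (simp add: g_def emeasure_eq_measure2)
  then show ?thesis
    by (rule that)
qed

section \<open>Initial segments for the order by decreasing |f|\<close>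

context
  fixes a :: ereal and I :: "real set" and f :: "real \<Rightarrow> real"
  assumes I: "I = einterval 0 a" and f: "f \<in> L0 I"
    and finite_distr: "\<And>s. 0 < s \<Longrightarrow> distr_fun I f s < \<infinity>"
begin

text \<open>The initial segments of \<open>I\<close> with respect to the lexicographic order: first by decreasing
  \<open>\<bar>f t\<bar>\<close>, then by increasing \<open>t\<close>.\<close>

definition top_part :: "real \<Rightarrow> ereal \<Rightarrow> real set" where
  "top_part s c = {t \<in> I. s < \<bar>f t\<bar>} \<union> {t \<in> I. \<bar>f t\<bar> = s \<and> ereal t < c}"

lemma top_part_chain: "top_part s c \<subseteq> top_part s' c' \<or> top_part s' c' \<subseteq> top_part s c"
proof (cases s s' rule: linorder_cases)
  case equal
  then show ?thesis
    by (cases "c \<le> c'") (auto simp: top_part_def)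
qed (auto simp: top_part_def)

lemma sets_top_part: "top_part s c \<in> sets lebesgue"
proof -
  have [measurable]: "f \<in> borel_measurable (lebesgue_on I)"
    using f by (simp add: L0_def)
  have [measurable]: "(\<lambda>t. t) \<in> borel_measurable (lebesgue_on I)"
    by (intro measurable_restrict_space1 measurable_completion) simp
  have "{t \<in> space (lebesgue_on I). s < \<bar>f t\<bar> \<or> \<bar>f t\<bar> = s \<and> ereal t < c} \<in> sets (lebesgue_on I)"
    by measurable
  moreover have "top_part s c = {t \<in> space (lebesgue_on I). s < \<bar>f t\<bar> \<or> \<bar>f t\<bar> = s \<and> ereal t < c}"
    by (auto simp: top_part_def)
  ultimately show ?thesis
    using sets_interval(2)[OF I] by (simp add: sets_restrict_space_iff)
qed

text \<open>\<open>f\<close> is real-valued, so its level sets shrink to the empty set, and their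
  finite measure allows continuity from above. This makes f* finite at every
  \<open>b > 0\<close>.\<close>

lemma exists_distr_fun_less:
  assumes "0 < b"
  obtains s where "0 < s" "distr_fun I f s < ennreal b"
proof -
  have "(INF n::nat. emeasure lebesgue {t \<in> I. real (Suc n) < \<bar>f t\<bar>}) = emeasure lebesgue (\<Inter>n::nat. {t \<in> I. real (Suc n) < \<bar>f t\<bar>})"
  proof (rule INF_emeasure_decseq)
    show "emeasure lebesgue {t \<in> I. real (Suc n) < \<bar>f t\<bar>} \<noteq> \<infinity>" for n
      using finite_distr[of "real (Suc n)"] by (simp add: distr_fun_def less_top)
  qed (use sets_level[OF I f] in \<open>auto simp: decseq_def\<close>)
  also have "(\<Inter>n::nat. {t \<in> I. real (Suc n) < \<bar>f t\<bar>}) = {}"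
  proof -
    have "\<exists>n. \<not> real (Suc n) < \<bar>f t\<bar>" for t
    proof -
      obtain n :: nat where "\<bar>f t\<bar> \<le> real n"
        using real_arch_simple by blast
      then show ?thesis
        by (intro exI[of _ n]) simp
    qed
    then show ?thesis
      by auto
  qed
  finally have "(INF n::nat. distr_fun I f (real (Suc n))) < ennreal b"
    using assms by (simp add: distr_fun_def)
  then obtain n where "distr_fun I f (real (Suc n)) < ennreal b"
    by (auto simp: INF_less_iff)
  then show ?thesis
    by (intro that[of "real (Suc n)"]) auto
qed

text \<open>The level is s = f*(b): the set {|f| > s} has measure at most \<open>b\<close> and {|f|
  \<ge> s} at least \<open>b\<close>. The missing measure is cut from the tie set \<open>L\<close> =
  {|f| = s}.\<close>

lemma exists_top_part:
  assumes b: "0 < b" "ennreal b < distr_fun I f 0"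
  obtains s c where "0 < s" "emeasure lebesgue (top_part s c) = ennreal b"
proof -
  obtain s1 where s1: "0 < s1" "distr_fun I f s1 < ennreal b"
    using exists_distr_fun_less[OF b(1)] by metis
  then have "rearr_fun I f b \<le> ennreal s1"
    using rearr_fun_le_iff[OF I f, of s1 b] by simp
  then have "rearr_fun I f b < top"
    by (rule le_less_trans) simp
  then obtain s where s: "rearr_fun I f b = ennreal s" "0 \<le> s"
    by (cases "rearr_fun I f b") auto
  have "0 < s"
    using less_rearr_fun_iff[OF I f, of 0 b] b s by (simp add: ennreal_less_iff)
  have d_le: "distr_fun I f s \<le> ennreal b"
    using rearr_fun_le_iff[OF I f, of s b] s by simp
  have d_ge: "ennreal b < distr_fun I f r" if "0 \<le> r" "r < s" for r
    using less_rearr_fun_iff[OF I f, of r b] that s by (simp add: ennreal_less_iff)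
  define L where "L = {t \<in> I. \<bar>f t\<bar> = s}"
  have top_eq: "top_part s c = {t \<in> I. s < \<bar>f t\<bar>} \<union> {t \<in> L. ereal t < c}" for c
    by (auto simp: top_part_def L_def)
  have L_sets: "{t \<in> L. ereal t < c} \<in> sets lebesgue" for c
  proof -
    have "top_part s c - {t \<in> I. s < \<bar>f t\<bar>} \<in> sets lebesgue"
      by (intro sets.Diff sets_top_part sets_level[OF I f])
    moreover have "top_part s c - {t \<in> I. s < \<bar>f t\<bar>} = {t \<in> L. ereal t < c}"
      by (auto simp: top_part_def L_def)
    ultimately show ?thesis
      by simp
  qed
  have eq: "emeasure lebesgue (top_part s c) = distr_fun I f s + emeasure lebesgue {t \<in> L. ereal t < c}" for c
    unfolding top_eq distr_fun_def
    by (intro plus_emeasure[symmetric] sets_level[OF I f] L_sets) (auto simp: L_def)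
  \<comment> \<open>Levels increasing to \<open>s\<close> give {|f| \<ge> s} in the limit. The first
    of them is 0, where the measure may be infinite; intersecting with {|f| > s/2} makes continuity
    from above available.\<close>
  have "ennreal b \<le> (INF n. emeasure lebesgue ({t \<in> I. s - s / real (Suc n) < \<bar>f t\<bar>} \<inter> {t \<in> I. s / 2 < \<bar>f t\<bar>}))"
  proof (intro INF_greatest)
    fix n
    have "max (s - s / real (Suc n)) (s / 2) < s"
      using divide_pos_pos[OF \<open>0 < s\<close>, of "real (Suc n)"] \<open>0 < s\<close> by simp
    moreover have "0 \<le> max (s - s / real (Suc n)) (s / 2)"
      using \<open>0 < s\<close> by (intro max.coboundedI2) simp
    ultimately have "ennreal b \<le> distr_fun I f (max (s - s / real (Suc n)) (s / 2))"
      by (intro less_imp_le[OF d_ge])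
    also have "\<dots> = emeasure lebesgue ({t \<in> I. s - s / real (Suc n) < \<bar>f t\<bar>} \<inter> {t \<in> I. s / 2 < \<bar>f t\<bar>})"
      unfolding distr_fun_def by (intro arg_cong[where f = "emeasure lebesgue"] set_eqI) (simp only: Int_iff mem_Collect_eq max_less_iff_conj, blast)
    finally show "ennreal b \<le> emeasure lebesgue ({t \<in> I. s - s / real (Suc n) < \<bar>f t\<bar>} \<inter> {t \<in> I. s / 2 < \<bar>f t\<bar>})" .
  qed
  also have "\<dots> = emeasure lebesgue (\<Inter>n. {t \<in> I. s - s / real (Suc n) < \<bar>f t\<bar>} \<inter> {t \<in> I. s / 2 < \<bar>f t\<bar>})"
  proof (rule INF_emeasure_decseq)
    show "decseq (\<lambda>n. {t \<in> I. s - s / real (Suc n) < \<bar>f t\<bar>} \<inter> {t \<in> I. s / 2 < \<bar>f t\<bar>})"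
    proof (rule decseq_SucI)
      fix n
      have "s - s / real (Suc n) \<le> s - s / real (Suc (Suc n))"
        using \<open>0 < s\<close> by (simp add: frac_le)
      then show "{t \<in> I. s - s / real (Suc (Suc n)) < \<bar>f t\<bar>} \<inter> {t \<in> I. s / 2 < \<bar>f t\<bar>}
        \<subseteq> {t \<in> I. s - s / real (Suc n) < \<bar>f t\<bar>} \<inter> {t \<in> I. s / 2 < \<bar>f t\<bar>}"
        by auto
    qed
    show "emeasure lebesgue ({t \<in> I. s - s / real (Suc n) < \<bar>f t\<bar>} \<inter> {t \<in> I. s / 2 < \<bar>f t\<bar>}) \<noteq> \<infinity>" for n
    proof -
      have "emeasure lebesgue ({t \<in> I. s - s / real (Suc n) < \<bar>f t\<bar>} \<inter> {t \<in> I. s / 2 < \<bar>f t\<bar>}) \<le> distr_fun I f (s / 2)"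
        unfolding distr_fun_def by (intro emeasure_mono sets_level[OF I f]) auto
      also have "\<dots> < \<infinity>"
        using \<open>0 < s\<close> by (intro finite_distr) simp
      finally show ?thesis
        by simp
    qed
    show "range (\<lambda>n. {t \<in> I. s - s / real (Suc n) < \<bar>f t\<bar>} \<inter> {t \<in> I. s / 2 < \<bar>f t\<bar>}) \<subseteq> sets lebesgue"
      by (intro image_subsetI sets.Int sets_level[OF I f])
  qed
  also have "(\<Inter>n. {t \<in> I. s - s / real (Suc n) < \<bar>f t\<bar>} \<inter> {t \<in> I. s / 2 < \<bar>f t\<bar>}) = top_part s \<infinity>"
  proof -
    have iff: "s \<le> y \<longleftrightarrow> (\<forall>n. s - s / real (Suc n) < y)" for y
    proof
      assume *: "\<forall>n. s - s / real (Suc n) < y"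
      have "(\<lambda>n. s - s * inverse (real (Suc n))) \<longlonglongrightarrow> s - s * 0"
        by (intro tendsto_intros LIMSEQ_inverse_real_of_nat)
      then show "s \<le> y"
        using * by (intro LIMSEQ_le_const2[of "\<lambda>n. s - s * inverse (real (Suc n))"]) (auto simp: divide_inverse less_imp_le)
    next
      assume "s \<le> y"
      then have "s - s / real (Suc n) < y" for n
        using divide_pos_pos[OF \<open>0 < s\<close>, of "real (Suc n)"] by simp
      then show "\<forall>n. s - s / real (Suc n) < y" ..
    qed
    have top_part: "top_part s \<infinity> = {t \<in> I. s \<le> \<bar>f t\<bar>}"
      by (auto simp: top_part_def)
    show ?thesis
    proof (intro set_eqI iffI)
      fix t assume "t \<in> (\<Inter>n. {t \<in> I. s - s / real (Suc n) < \<bar>f t\<bar>} \<inter> {t \<in> I. s / 2 < \<bar>f t\<bar>})"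
      then have "t \<in> I" "\<forall>n. s - s / real (Suc n) < \<bar>f t\<bar>"
        by blast+
      then show "t \<in> top_part s \<infinity>"
        unfolding top_part mem_Collect_eq iff by simp
    next
      fix t assume "t \<in> top_part s \<infinity>"
      then have t: "t \<in> I" "s \<le> \<bar>f t\<bar>"
        by (auto simp: top_part)
      then have "s / 2 < \<bar>f t\<bar>"
        using \<open>0 < s\<close> by simp
      with t show "t \<in> (\<Inter>n. {t \<in> I. s - s / real (Suc n) < \<bar>f t\<bar>} \<inter> {t \<in> I. s / 2 < \<bar>f t\<bar>})"
        unfolding iff by blast
    qed
  qed
  finally have "ennreal b \<le> distr_fun I f s + emeasure lebesgue L"
    using eq[of \<infinity>] by simp
  moreover have "distr_fun I f s < top"
    using finite_distr[OF \<open>0 < s\<close>] by simp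
  then obtain d where d: "distr_fun I f s = ennreal d" "0 \<le> d"
    by (cases "distr_fun I f s") auto
  ultimately have \<beta>: "ennreal (b - d) \<le> emeasure lebesgue L" "d \<le> b"
    using d_le b by (auto simp: ennreal_minus_le_iff simp flip: ennreal_minus)
  have "L \<in> lmeasurable"
  proof (rule fmeasurableI)
    show "L \<in> sets lebesgue"
      using L_sets[of \<infinity>] by simp
    have "emeasure lebesgue L \<le> distr_fun I f (s / 2)"
      unfolding distr_fun_def L_def using \<open>0 < s\<close> by (intro emeasure_mono sets_level[OF I f] subsetI CollectI) simp
    also have "\<dots> < \<infinity>"
      using \<open>0 < s\<close> by (intro finite_distr) simp
    finally show "emeasure lebesgue L < \<infinity>" .
  qed
  moreover have "L \<subseteq> {0<..}"
    by (auto simp: L_def mem_interval_iff[OF I])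
  ultimately obtain c where "emeasure lebesgue {t \<in> L. ereal t < c} = ennreal (b - d)"
    using \<beta> exists_initial_segment_measure_eq[of L "b - d"] by (metis diff_ge_0_iff_ge)
  then have "emeasure lebesgue (top_part s c) = ennreal b"
    using eq[of c] d \<beta> by (simp flip: ennreal_plus)
  with \<open>0 < s\<close> show ?thesis
    by (rule that)
qed

text \<open>The segments are chosen independently for each \<open>b\<close>. They belong to a chain,
  so one of smaller measure must lie inside one of larger measure and no compatible choice is
  required. Once \<open>b\<close> reaches the measure of the support, the whole support is
  taken.\<close>

lemma exists_nested_parts:
  obtains B :: "real \<Rightarrow> real set"
  where "\<And>b. 0 < b \<Longrightarrow> B b \<in> sets lebesgue" "\<And>b. 0 < b \<Longrightarrow> B b \<subseteq> {t \<in> I. 0 < \<bar>f t\<bar>}"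
    "\<And>b. 0 < b \<Longrightarrow> emeasure lebesgue (B b) = min (ennreal b) (distr_fun I f 0)"
    "\<And>b b'. 0 < b \<Longrightarrow> b \<le> b' \<Longrightarrow> B b \<subseteq> B b'"
    "\<And>b s. 0 < b \<Longrightarrow> 0 < s \<Longrightarrow> distr_fun I f s < ennreal b \<Longrightarrow> {t \<in> I. s < \<bar>f t\<bar>} \<subseteq> B b"
proof -
  let ?S = "{t \<in> I. 0 < \<bar>f t\<bar>}"
  have "\<exists>X. 0 < b \<longrightarrow> ennreal b < distr_fun I f 0 \<longrightarrow>
      (\<exists>s c. 0 < s \<and> X = top_part s c \<and> emeasure lebesgue (top_part s c) = ennreal b)" for b
  proof (cases "0 < b \<and> ennreal b < distr_fun I f 0")
    case True
    then obtain s c where "0 < s" "emeasure lebesgue (top_part s c) = ennreal b"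
      using exists_top_part[of b] by blast
    then show ?thesis
      by blast
  qed blast
  then obtain X where X: "\<And>b. 0 < b \<Longrightarrow> ennreal b < distr_fun I f 0 \<Longrightarrow>
      \<exists>s c. 0 < s \<and> X b = top_part s c \<and> emeasure lebesgue (top_part s c) = ennreal b"
    by metis
  define B where "B b = (if ennreal b < distr_fun I f 0 then X b else ?S)" for b
  have sets: "B b \<in> sets lebesgue" if "0 < b" for b
    using X[OF that] sets_top_part sets_level[OF I f, of 0] by (auto simp: B_def simp del: zero_less_abs_iff)
  have sub: "B b \<subseteq> ?S" if b: "0 < b" for b
  proof (cases "ennreal b < distr_fun I f 0")
    case True
    then obtain s c where "0 < s" "X b = top_part s c"
      using X[OF b] by blast
    then show ?thesis
      using True by (auto simp: B_def top_part_def)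
  qed (simp add: B_def)
  have meas: "emeasure lebesgue (B b) = min (ennreal b) (distr_fun I f 0)" if "0 < b" for b
    using X[OF that] by (auto simp: B_def min_def distr_fun_def not_less)
  have nested: "top_part s c \<subseteq> B b'"
    if b': "emeasure lebesgue (top_part s c) < ennreal b'" "0 < b'" "0 < s" for s c b'
  proof (cases "ennreal b' < distr_fun I f 0")
    case True
    then obtain s' c' where X': "X b' = top_part s' c'"
      "emeasure lebesgue (top_part s' c') = ennreal b'"
      using X[OF b'(2)] by blast
    have "\<not> top_part s' c' \<subseteq> top_part s c"
      using emeasure_mono[OF _ sets_top_part, of "top_part s' c'" s c] X'(2) b'(1) by (auto simp flip: not_le)
    then show ?thesis
      using top_part_chain[of s c s' c'] X'(1) True by (auto simp: B_def)
  next
    case False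
    then show ?thesis
      using b'(3) by (auto simp: B_def top_part_def)
  qed
  show ?thesis
  proof (rule that[OF sets sub meas])
    fix b b' :: real assume b: "0 < b" "b \<le> b'"
    show "B b \<subseteq> B b'"
    proof (cases "b = b' \<or> \<not> ennreal b < distr_fun I f 0")
      case True
      then have "b = b' \<or> \<not> ennreal b' < distr_fun I f 0"
        using ennreal_leI[OF b(2)] le_less_trans[of "ennreal b" "ennreal b'" "distr_fun I f 0"] by blast
      then show ?thesis
        using True by (auto simp: B_def)
    next
      case False
      then obtain s c where "0 < s" "B b = top_part s c" "emeasure lebesgue (top_part s c) = ennreal b"
        using X[OF b(1)] by (auto simp: B_def)
      then show ?thesis
        using nested[of s c b'] False b by (simp add: ennreal_less_iff)
    qed
  next
    fix b s :: real assume b: "0 < b" "0 < s" "distr_fun I f s < ennreal b"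
    \<comment> \<open>A strict level set is the segment that takes nothing from its tie set.\<close>
    have "top_part s (-\<infinity>) = {t \<in> I. s < \<bar>f t\<bar>}"
      by (auto simp: top_part_def)
    then show "{t \<in> I. s < \<bar>f t\<bar>} \<subseteq> B b"
      using nested[of s "-\<infinity>" b] b by (simp add: distr_fun_def)
  qed
qed

end

text \<open>The rank of \<open>t\<close> is the infimum of the measures \<open>b\<close> of chosen
  segments containing \<open>t\<close>.\<close>

lemma exists_rank_function:
  assumes I: "I = einterval 0 a" and f: "f \<in> L0 I"
    and finite_distr: "\<And>s. 0 < s \<Longrightarrow> distr_fun I f s < \<infinity>"
  defines "S \<equiv> {t \<in> I. 0 < \<bar>f t\<bar>}"
  obtains \<tau> :: "real \<Rightarrow> real"
  where "\<tau> \<in> borel_measurable (lebesgue_on S)" "\<And>t. t \<in> S \<Longrightarrow> 0 \<le> \<tau> t"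
    "\<And>r. 0 \<le> r \<Longrightarrow> emeasure lebesgue {t \<in> S. \<tau> t \<le> r} = min (ennreal r) (distr_fun I f 0)"
    "\<And>s t. 0 < s \<Longrightarrow> t \<in> I \<Longrightarrow> s < \<bar>f t\<bar> \<Longrightarrow> ennreal (\<tau> t) \<le> distr_fun I f s"
proof -
  obtain B :: "real \<Rightarrow> real set"
    where B: "\<And>b. 0 < b \<Longrightarrow> B b \<in> sets lebesgue" "\<And>b. 0 < b \<Longrightarrow> B b \<subseteq> S"
    "\<And>b. 0 < b \<Longrightarrow> emeasure lebesgue (B b) = min (ennreal b) (distr_fun I f 0)"
    "\<And>b b'. 0 < b \<Longrightarrow> b \<le> b' \<Longrightarrow> B b \<subseteq> B b'"
    "\<And>b s. 0 < b \<Longrightarrow> 0 < s \<Longrightarrow> distr_fun I f s < ennreal b \<Longrightarrow> {t \<in> I. s < \<bar>f t\<bar>} \<subseteq> B b"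
    using exists_nested_parts[OF I f finite_distr, folded S_def] by blast
  have S_sets: "S \<in> sets lebesgue"
    unfolding S_def by (rule sets_level[OF I f])
  define K where "K t = {b. 0 < b \<and> t \<in> B b}" for t
  define \<tau> where "\<tau> t = Inf (K t)" for t
  have K_bdd: "bdd_below (K t)" for t
    by (rule bdd_belowI[of _ 0]) (simp add: K_def)
  have K_level: "b \<in> K t" if "0 < s" "t \<in> I" "s < \<bar>f t\<bar>" "distr_fun I f s < ennreal b" for b s t
  proof -
    have "0 < ennreal b"
      using that(4) by (rule le_less_trans[OF zero_le])
    then show ?thesis
      using that B(5)[of b s] by (auto simp: K_def ennreal_less_zero_iff)
  qed
  \<comment> \<open>Finiteness of the level sets enters here: \<open>t\<close> lies in {|f| > |f
    t|/2}, so any \<open>b\<close> above the measure of that set will do.\<close>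
  have K_nonempty: "K t \<noteq> {}" if "t \<in> S" for t
  proof -
    from that have t: "t \<in> I" "0 < \<bar>f t\<bar> / 2" "\<bar>f t\<bar> / 2 < \<bar>f t\<bar>"
      by (auto simp: S_def)
    obtain d where "distr_fun I f (\<bar>f t\<bar> / 2) = ennreal d" "0 \<le> d"
      using finite_distr[OF t(2)] by (cases "distr_fun I f (\<bar>f t\<bar> / 2)") auto
    then have "d + 1 \<in> K t"
      using t by (intro K_level[of "\<bar>f t\<bar> / 2"]) (auto simp: ennreal_less_iff)
    then show ?thesis
      by blast
  qed
  have less_iff: "\<tau> t < r \<longleftrightarrow> (\<exists>b\<in>K t. b < r)" if "t \<in> S" for t r
    unfolding \<tau>_def using K_bdd K_nonempty[OF that] by (simp add: cInf_less_iff)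
  have nonneg: "0 \<le> \<tau> t" if "t \<in> S" for t
    using less_iff[OF that, of 0] by (auto simp: K_def not_less[symmetric])
  \<comment> \<open>By nesting, rational indices suffice, which leaves a countable union.\<close>
  have less_eq: "{t \<in> S. \<tau> t < r} = (\<Union>q\<in>{q\<in>\<rat>. 0 < q \<and> q < r}. B q)" for r
  proof (intro set_eqI iffI)
    fix t assume t: "t \<in> {t \<in> S. \<tau> t < r}"
    then obtain b where b: "0 < b" "t \<in> B b" "b < r"
      using less_iff[of t r] by (auto simp: K_def)
    obtain q where q: "q \<in> \<rat>" "b < q" "q < r"
      using Rats_dense_in_real[OF b(3)] by blast
    then have "t \<in> B q"
      using B(4)[of b q] b by auto
    with q b show "t \<in> (\<Union>q\<in>{q\<in>\<rat>. 0 < q \<and> q < r}. B q)"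
      by (auto intro!: bexI[of _ q])
  next
    fix t assume "t \<in> (\<Union>q\<in>{q\<in>\<rat>. 0 < q \<and> q < r}. B q)"
    then obtain q where q: "0 < q" "q < r" "t \<in> B q"
      by blast
    moreover have "t \<in> S"
      using B(2) q by blast
    ultimately show "t \<in> {t \<in> S. \<tau> t < r}"
      using less_iff[of t r] by (auto simp: K_def)
  qed
  have "countable {q\<in>\<rat>. 0 < q \<and> q < (r::real)}" for r
    by (rule countable_subset[OF _ countable_rat]) auto
  then have less_sets: "{t \<in> S. \<tau> t < r} \<in> sets lebesgue" for r
    unfolding less_eq using B(1) by (intro sets.countable_UN'') auto
  have measurable: "\<tau> \<in> borel_measurable (lebesgue_on S)"
    using less_sets S_sets by (intro borel_measurableI_less) (auto simp: sets_restrict_space_iff)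
  have "{t \<in> space (lebesgue_on S). \<tau> t \<le> r} \<in> sets (lebesgue_on S)" for r
    using measurable by measurable
  then have le_sets: "{t \<in> S. \<tau> t \<le> r} \<in> sets lebesgue" for r
    using S_sets by (auto simp: sets_restrict_space_iff)
  have emeasure_le: "emeasure lebesgue {t \<in> S. \<tau> t \<le> r} = min (ennreal r) (distr_fun I f 0)" if r: "0 \<le> r" for r
  proof (rule antisym)
    \<comment> \<open>The infimum defining the rank need not be attained, so {\<tau> \<le> r} is
      caught only by segments with index beyond \<open>r\<close>; \<open>r'\<close> then tends to
      \<open>r\<close>.\<close>
    have upper: "emeasure lebesgue {t \<in> S. \<tau> t \<le> r} \<le> min (ennreal r') (distr_fun I f 0)" if "r < r'" for r'
    proof -
      have r': "0 < r'"
        using r that by simp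
      have "{t \<in> S. \<tau> t \<le> r} \<subseteq> B r'"
      proof
        fix t assume t: "t \<in> {t \<in> S. \<tau> t \<le> r}"
        then have "\<tau> t < r'"
          using that by simp
        then obtain b where "0 < b" "t \<in> B b" "b < r'"
          using less_iff[of t r'] t by (auto simp: K_def)
        then show "t \<in> B r'"
          using B(4)[of b r'] by auto
      qed
      then have "emeasure lebesgue {t \<in> S. \<tau> t \<le> r} \<le> emeasure lebesgue (B r')"
        using B(1)[OF r'] by (rule emeasure_mono)
      then show ?thesis
        using B(3)[OF r'] by simp
    qed
    have "emeasure lebesgue {t \<in> S. \<tau> t \<le> r} \<le> ennreal r"
    proof (rule ennreal_le_epsilon)
      fix e :: real assume "0 < e"
      then show "emeasure lebesgue {t \<in> S. \<tau> t \<le> r} \<le> ennreal r + ennreal e"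
        using upper[of "r + e"] r by simp
    qed
    moreover have "emeasure lebesgue {t \<in> S. \<tau> t \<le> r} \<le> distr_fun I f 0"
      using upper[of "r + 1"] by simp
    ultimately show "emeasure lebesgue {t \<in> S. \<tau> t \<le> r} \<le> min (ennreal r) (distr_fun I f 0)"
      by simp
    show "min (ennreal r) (distr_fun I f 0) \<le> emeasure lebesgue {t \<in> S. \<tau> t \<le> r}"
    proof (cases "r = 0")
      case False
      with r have r: "0 < r"
        by simp
      have "B r \<subseteq> {t \<in> S. \<tau> t \<le> r}"
      proof
        fix t assume "t \<in> B r"
        then have "r \<in> K t"
          using r by (simp add: K_def)
        then have "\<tau> t \<le> r"
          unfolding \<tau>_def by (intro cInf_lower K_bdd)
        then show "t \<in> {t \<in> S. \<tau> t \<le> r}"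
          using B(2)[OF r] \<open>t \<in> B r\<close> by blast
      qed
      then have "emeasure lebesgue (B r) \<le> emeasure lebesgue {t \<in> S. \<tau> t \<le> r}"
        using le_sets by (rule emeasure_mono)
      then show ?thesis
        using B(3)[OF r] by simp
    qed simp
  qed
  show ?thesis
  proof (rule that[OF measurable nonneg emeasure_le])
    fix s t :: real assume st: "0 < s" "t \<in> I" "s < \<bar>f t\<bar>"
    obtain d where d: "distr_fun I f s = ennreal d" "0 \<le> d"
      using finite_distr[OF st(1)] by (cases "distr_fun I f s") auto
    have "\<tau> t \<le> d"
    proof (rule field_le_epsilon)
      fix e :: real assume "0 < e"
      then have "d + e \<in> K t"
        using d st by (intro K_level[of s]) (auto simp: ennreal_less_iff)
      then show "\<tau> t \<le> d + e"
        unfolding \<tau>_def by (intro cInf_lower K_bdd)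
    qed
    then show "ennreal (\<tau> t) \<le> distr_fun I f s"
      using d by (simp add: ennreal_leI)
  qed
qed

text \<open>Both measures agree on the half-lines \<open>{..r}\<close>, a generating family stable
  under intersection and of finite measure. Hence \<open>\<tau>\<close> carries Lebesgue measure on
  \<open>S\<close> to Lebesgue measure on an initial interval.\<close>

lemma distr_rank_function:
  fixes \<tau> :: "real \<Rightarrow> real"
  assumes S: "S \<in> sets lebesgue" and \<tau>: "\<tau> \<in> borel_measurable (lebesgue_on S)" "\<And>t. t \<in> S \<Longrightarrow> 0 \<le> \<tau> t"
    and le: "\<And>r. 0 \<le> r \<Longrightarrow> emeasure lebesgue {t \<in> S. \<tau> t \<le> r} = min (ennreal r) m"
  shows "distr (lebesgue_on S) borel \<tau> = density lborel (indicator {r. 0 < r \<and> ennreal r < m})"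
proof -
  let ?J = "{r::real. 0 < r \<and> ennreal r < m}"
  have "?J \<in> sets borel"
    by measurable
  then have J: "?J \<in> sets lborel"
    by simp
  have distr: "emeasure (distr (lebesgue_on S) borel \<tau>) {..r} = (if 0 \<le> r then min (ennreal r) m else 0)" for r
  proof -
    have "emeasure (distr (lebesgue_on S) borel \<tau>) {..r} = emeasure lebesgue {t \<in> S. \<tau> t \<le> r}"
      using S \<tau>(1) by (subst emeasure_distr) (auto simp: emeasure_restrict_space vimage_def Int_def conj_commute)
    moreover have "{t \<in> S. \<tau> t \<le> r} = {}" if "r < 0"
      using \<tau>(2) that by force
    ultimately show ?thesis
      using le[of r] by (cases "0 \<le> r") simp_all
  qed
  have density: "emeasure (density lborel (indicator ?J)) {..r} = (if 0 \<le> r then min (ennreal r) m else 0)" for r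
  proof -
    have "emeasure (density lborel (indicator ?J)) {..r} = emeasure lborel (?J \<inter> {..r})"
      using J by (intro emeasure_restricted) simp_all
    also have "\<dots> = (if 0 \<le> r then min (ennreal r) m else 0)"
    proof (cases "0 \<le> r")
      case True
      show ?thesis
      proof (cases "ennreal r < m")
        case less: True
        then have "?J \<inter> {..r} = {0<..r}"
          by (auto intro: le_less_trans[OF ennreal_leI])
        then show ?thesis
          using True less by (simp add: min.absorb1 less_imp_le)
      next
        case False
        then obtain m' where m': "m = ennreal m'" "0 \<le> m'" "m' \<le> r"
          using True by (cases m) (auto simp: not_less ennreal_le_iff)
        then have "?J \<inter> {..r} = {0<..<m'}"
          by (auto simp: ennreal_less_iff)
        then show ?thesis
          using m' True by (simp add: min_def ennreal_le_iff)
      qed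
    next
      case False
      then have "?J \<inter> {..r} = {}"
        by auto
      then show ?thesis
        using False by simp
    qed
    finally show ?thesis .
  qed
  show ?thesis
  proof (rule measure_eqI_generator_eq[where E = "range (\<lambda>r::real. {..r})" and \<Omega> = UNIV and A = "\<lambda>n::nat. {..real n}"])
    show "Int_stable (range (\<lambda>r::real. {..r}))"
      by (auto simp: Int_stable_def)
    show "emeasure (distr (lebesgue_on S) borel \<tau>) X = emeasure (density lborel (indicator ?J)) X"
      if "X \<in> range (\<lambda>r::real. {..r})" for X
      using that distr density by auto
    show "emeasure (distr (lebesgue_on S) borel \<tau>) {..real n} \<noteq> \<infinity>" for n :: nat
      unfolding distr by (auto simp: min_def)
    show "(\<Union>n::nat. {..real n}) = UNIV"
      using real_arch_simple by auto
  qed (auto simp: borel_eq_atMost)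
qed

section \<open>Attaining the infimum for functions\<close>

lemma borel_measurable_antimono_on:
  fixes w :: "real \<Rightarrow> real"
  assumes "antimono_on A w" "A \<in> sets borel"
  shows "(\<lambda>t. if t \<in> A then w t else 0) \<in> borel_measurable borel"
proof -
  have "mono_on A (\<lambda>t. - w t)"
    using assms(1) by (auto simp: monotone_on_def)
  then have "(\<lambda>t. - (- w t)) \<in> borel_measurable (restrict_space borel A)"
    by (intro borel_measurable_uminus borel_measurable_mono_on_fnc)
  then show ?thesis
    using assms(2) by (simp add: measurable_restrict_space_iff)
qed

text \<open>If {|f| > s} had infinite measure, f* would exceed \<open>s\<close> on all of
  \<open>I\<close>, which is then the half-line. From 1 on \<open>w\<close> is at most
  \<open>w 1\<close>, so the integrand stays above a positive constant there; near 0
  \<open>w\<close> may be unbounded.\<close>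

lemma (in orlicz) distr_fun_finite:
  assumes I: "I = einterval 0 a" and w: "weight_function I w" and f: "f \<in> L0 I"
    and finite: "(\<integral>\<^sup>+ t. orlicz_term \<phi> (rearr_fun I f t) (w t) \<partial>lebesgue_on I) < \<infinity>"
    and s: "0 < s"
  shows "distr_fun I f s < \<infinity>"
proof (rule ccontr)
  assume "\<not> ?thesis"
  then have inf: "distr_fun I f s = \<infinity>"
    by (simp flip: less_top)
  moreover have "distr_fun I f s \<le> emeasure lebesgue I"
    unfolding distr_fun_def using sets_interval[OF I] by (intro emeasure_mono) auto
  ultimately have "emeasure lebesgue I = \<infinity>"
    by (simp add: top_unique)
  then have mem: "t \<in> I" if "0 < t" for t
    using that by (intro mem_interval_of_less_emeasure[OF I]) auto
  have w': "0 \<le> w t" "1 \<le> t \<Longrightarrow> w t \<le> w 1" if "t \<in> I" for t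
    using w that mem[of 1] by (auto simp: weight_function_def monotone_on_def)
  \<comment> \<open>Adding 1 keeps the weight positive when \<open>w 1 = 0\<close>.\<close>
  define c where "c = orlicz_term \<phi> (ennreal s) (w 1 + 1)"
  have w1: "0 < w 1 + 1"
    using w'(1)[OF mem[of 1]] by simp
  then have "0 < c"
    using s phi_less[of 0 "s / (w 1 + 1)"] by (auto simp: c_def orlicz_term_ennreal)
  have "c * emeasure (lebesgue_on I) {1..} = (\<integral>\<^sup>+ t. c * indicator {1..} t \<partial>lebesgue_on I)"
    using mem sets_interval[OF I] by (subst nn_integral_cmult_indicator) (auto simp: sets_restrict_space_iff intro!: mem)
  also have "\<dots> \<le> (\<integral>\<^sup>+ t. orlicz_term \<phi> (rearr_fun I f t) (w t) \<partial>lebesgue_on I)"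
  proof (rule nn_integral_mono)
    fix t assume "t \<in> space (lebesgue_on I)"
    then have t: "t \<in> I"
      by simp
    have "c \<le> orlicz_term \<phi> (rearr_fun I f t) (w t)" if "1 \<le> t"
    proof -
      have "c \<le> orlicz_term \<phi> (ennreal s) (w t)"
        unfolding c_def using w'(1)[OF t] w'(2)[OF t that] by (intro orlicz_term_antimono) auto
      also have "\<dots> \<le> orlicz_term \<phi> (rearr_fun I f t) (w t)"
        using less_rearr_fun_iff[OF I f, of s t] s inf w'(1)[OF t]
        by (intro orlicz_term_mono) (auto simp: less_imp_le)
      finally show ?thesis .
    qed
    then show "c * indicator {1..} t \<le> orlicz_term \<phi> (rearr_fun I f t) (w t)"
      by (simp add: indicator_def)
  qed
  finally have "c * emeasure (lebesgue_on I) {1..} < \<infinity>"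
    using finite by (rule le_less_trans)
  moreover have "emeasure (lebesgue_on I) {1..} = \<infinity>"
    using mem sets_interval[OF I] emeasure_lborel_atLeast[of 1] by (subst emeasure_restrict_space) (auto intro!: mem)
  ultimately show False
    using \<open>0 < c\<close> by (simp add: ennreal_mult_top split: if_splits)
qed

text \<open>Since \<open>w\<close> decreases, \<open>v\<close> exceeds \<open>w t\<close> only at
  ranks up to \<open>t\<close>, that is on measure at most \<open>t\<close>; this is v* \<le> w. The
  bound for the integral is the change of variables along \<open>\<tau>\<close> after replacing |f|
  by f* at the rank.\<close>

lemma (in orlicz) exists_le_nn_integral_rearr_fun:
  assumes I: "I = einterval 0 a" and w: "weight_function I w" and f: "f \<in> L0 I"
    and finite: "(\<integral>\<^sup>+ t. orlicz_term \<phi> (rearr_fun I f t) (w t) \<partial>lebesgue_on I) < \<infinity>"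
  obtains v where "v \<in> L0 I" "\<And>t. t \<in> I \<Longrightarrow> rearr_fun I v t \<le> ennreal (w t)" "\<And>t. t \<in> I \<Longrightarrow> 0 \<le> v t"
    "(\<integral>\<^sup>+ t. orlicz_term \<phi> (ennreal \<bar>f t\<bar>) (v t) \<partial>lebesgue_on I)
      \<le> (\<integral>\<^sup>+ t. orlicz_term \<phi> (rearr_fun I f t) (w t) \<partial>lebesgue_on I)"
proof -
  define S where "S = {t \<in> I. 0 < \<bar>f t\<bar>}"
  define m where "m = distr_fun I f 0"
  define J where "J = {r::real. 0 < r \<and> ennreal r < m}"
  obtain \<tau> :: "real \<Rightarrow> real"
    where \<tau>: "\<tau> \<in> borel_measurable (lebesgue_on S)" "\<And>t. t \<in> S \<Longrightarrow> 0 \<le> \<tau> t"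
      and \<tau>_le: "\<And>r. 0 \<le> r \<Longrightarrow> emeasure lebesgue {t \<in> S. \<tau> t \<le> r} = min (ennreal r) m"
      and \<tau>_distr: "\<And>s t. 0 < s \<Longrightarrow> t \<in> I \<Longrightarrow> s < \<bar>f t\<bar> \<Longrightarrow> ennreal (\<tau> t) \<le> distr_fun I f s"
    using exists_rank_function[OF I f distr_fun_finite[OF I w f finite], folded S_def m_def] by blast
  note [measurable] = sets_interval[OF I]
  have S[measurable]: "S \<in> sets lebesgue"
    unfolding S_def by (rule sets_level[OF I f])
  have "J \<in> sets borel"
    unfolding J_def by measurable
  then have J[measurable]: "J \<in> sets borel" "J \<in> sets lborel" "J \<in> sets lebesgue"
    by simp_all
  have distr: "distr (lebesgue_on S) borel \<tau> = density lborel (indicator J)"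
    unfolding J_def by (rule distr_rank_function[OF S \<tau> \<tau>_le])
  have J_sub: "J \<subseteq> I"
  proof
    fix r assume "r \<in> J"
    moreover have "m \<le> emeasure lebesgue I"
      unfolding m_def distr_fun_def by (intro emeasure_mono) auto
    ultimately show "r \<in> I"
      by (intro mem_interval_of_less_emeasure[OF I]) (auto simp: J_def)
  qed
  have w': "\<And>t. t \<in> I \<Longrightarrow> 0 \<le> w t" "antimono_on I w"
    using w by (auto simp: weight_function_def)
  \<comment> \<open>Composition with \<open>\<tau>\<close> calls for a Borel function on the whole
    line; Lebesgue measurability of \<open>w\<close> would not survive it, but monotonicity makes
    \<open>w\<close> Borel on \<open>I\<close>.\<close>
  define w0 where "w0 t = (if t \<in> I then w t else 0)" for t
  have w0[measurable]: "w0 \<in> borel_measurable borel"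
    unfolding w0_def by (intro borel_measurable_antimono_on w'(2)) measurable
  have w0_nonneg: "0 \<le> w0 t" for t
    using w'(1) by (simp add: w0_def)
  \<comment> \<open>Off the support the integrand is 0 for every weight, and the value 0 does not
    enlarge v*.\<close>
  define v where "v t = (if t \<in> S then w0 (\<tau> t) else 0)" for t
  have v: "v \<in> L0 I"
  proof -
    have "(\<lambda>t. w0 (\<tau> t)) \<in> borel_measurable (lebesgue_on S)"
      using \<tau>(1) by measurable
    then have "v \<in> borel_measurable lebesgue"
      unfolding v_def using S by (simp add: measurable_restrict_space_iff)
    then show ?thesis
      by (simp add: L0_def measurable_restrict_space1)
  qed
  \<comment> \<open>Since \<open>\<tau>\<close> preserves measure, countably many exceptional ranks
    pull back to a null set.\<close>
  have AE_J: "AE t in lebesgue_on S. P (\<tau> t)" if "\<And>r. r \<in> J \<Longrightarrow> r \<notin> N \<Longrightarrow> P r" "countable N" and [measurable]: "Measurable.pred borel P" for P N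
  proof -
    have "AE r in lborel. r \<notin> N"
      using that(2) by (intro AE_not_in countable_imp_null_set_lborel)
    then have "AE r in density lborel (indicator J). P r"
      using J that(1) by (subst AE_density) (auto simp: indicator_def elim!: eventually_mono)
    then have "AE r in distr (lebesgue_on S) borel \<tau>. P r"
      unfolding distr .
    then show ?thesis
      using \<tau>(1) by (subst (asm) AE_distr_iff) auto
  qed
  show ?thesis
  proof (rule that[OF v])
    fix t assume t: "t \<in> I"
    then show "0 \<le> v t"
      using w0_nonneg by (simp add: v_def)
    have "distr_fun I v (w t) \<le> emeasure lebesgue {r \<in> S. \<tau> r \<le> t}"
      unfolding distr_fun_def
    proof (rule emeasure_mono)
      show "{r \<in> I. w t < \<bar>v r\<bar>} \<subseteq> {r \<in> S. \<tau> r \<le> t}"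
      proof
        fix r assume "r \<in> {r \<in> I. w t < \<bar>v r\<bar>}"
        then have "w t < \<bar>v r\<bar>"
          by simp
        then have r: "r \<in> S" "\<tau> r \<in> I" "w t < w (\<tau> r)"
          using w'(1)[OF t] w0_nonneg[of "\<tau> r"] by (auto simp: v_def w0_def split: if_splits)
        then have "\<tau> r \<le> t"
          using w'(2) t by (force simp: monotone_on_def not_le[symmetric])
        with r show "r \<in> {r \<in> S. \<tau> r \<le> t}"
          by simp
      qed
      have "{r \<in> space (lebesgue_on S). \<tau> r \<le> t} \<in> sets (lebesgue_on S)"
        using \<tau>(1) by measurable
      then show "{r \<in> S. \<tau> r \<le> t} \<in> sets lebesgue"
        using S by (auto simp: sets_restrict_space_iff)
    qed
    also have "\<dots> \<le> ennreal t"
      using t \<tau>_le[of t] by (simp add: mem_interval_iff[OF I])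
    finally show "rearr_fun I v t \<le> ennreal (w t)"
      using rearr_fun_le_iff[OF I v w'(1)[OF t]] by simp
  next
    let ?F = "\<lambda>r. orlicz_term \<phi> (rearr_fun I f r) (w0 r)"
    have F[measurable]: "?F \<in> borel_measurable borel"
      by (intro borel_measurable_orlicz_term borel_measurable_rearr_fun[OF I f] w0 w0_nonneg)
    have "AE t in lebesgue_on S. s < \<bar>f t\<bar> \<longrightarrow> ennreal s < rearr_fun I f (\<tau> t)" if s: "0 < s" for s
    proof -
      \<comment> \<open>The rank bound is weak, but f* > s at the rank demands a strict one;
        equality fixes a single rank.\<close>
      have "AE t in lebesgue_on S. ennreal (\<tau> t) \<noteq> distr_fun I f s"
      proof (rule AE_J[of "{enn2real (distr_fun I f s)}"])
        fix r assume "r \<in> J" "r \<notin> {enn2real (distr_fun I f s)}"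
        then have "0 \<le> r" "r \<noteq> enn2real (distr_fun I f s)"
          by (auto simp: J_def)
        then show "ennreal r \<noteq> distr_fun I f s"
          by (metis enn2real_ennreal)
      qed simp_all
      then show ?thesis
      proof (rule AE_mp, intro AE_I2 impI)
        fix t assume t: "t \<in> space (lebesgue_on S)" "ennreal (\<tau> t) \<noteq> distr_fun I f s" "s < \<bar>f t\<bar>"
        then have "ennreal (\<tau> t) < distr_fun I f s"
          using \<tau>_distr[of s t] s by (auto simp: S_def order.order_iff_strict)
        then show "ennreal s < rearr_fun I f (\<tau> t)"
          using s by (simp add: less_rearr_fun_iff[OF I f])
      qed
    qed
    \<comment> \<open>Rational levels keep the union of the null sets null.\<close>
    then have "AE t in lebesgue_on S. \<forall>s\<in>{s\<in>\<rat>. 0 < s}. s < \<bar>f t\<bar> \<longrightarrow> ennreal s < rearr_fun I f (\<tau> t)"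
      by (subst AE_ball_countable) (auto intro: countable_subset[OF _ countable_rat])
    then have AE_le: "AE t in lebesgue_on S. ennreal \<bar>f t\<bar> \<le> rearr_fun I f (\<tau> t)"
    proof (rule AE_mp, intro AE_I2 impI)
      fix t assume *: "\<forall>s\<in>{s\<in>\<rat>. 0 < s}. s < \<bar>f t\<bar> \<longrightarrow> ennreal s < rearr_fun I f (\<tau> t)"
      show "ennreal \<bar>f t\<bar> \<le> rearr_fun I f (\<tau> t)"
      proof (rule ccontr)
        assume "\<not> ?thesis"
        then have less: "rearr_fun I f (\<tau> t) < ennreal \<bar>f t\<bar>"
          by simp
        then obtain y where y: "rearr_fun I f (\<tau> t) = ennreal y" "0 \<le> y" "y < \<bar>f t\<bar>"
          by (cases "rearr_fun I f (\<tau> t)") (auto simp: ennreal_less_iff)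
        obtain q where q: "q \<in> \<rat>" "y < q" "q < \<bar>f t\<bar>"
          using Rats_dense_in_real[OF y(3)] by blast
        then show False
          using * y by (auto simp: ennreal_less_iff dest!: bspec[of _ _ q])
      qed
    qed
    have "(\<integral>\<^sup>+ t. orlicz_term \<phi> (ennreal \<bar>f t\<bar>) (v t) \<partial>lebesgue_on I)
      = (\<integral>\<^sup>+ t. orlicz_term \<phi> (ennreal \<bar>f t\<bar>) (v t) \<partial>lebesgue_on S)"
    proof (subst (1 2) nn_integral_restrict_space)
      show "S \<inter> space lebesgue \<in> sets lebesgue" "I \<inter> space lebesgue \<in> sets lebesgue"
        by simp_all
    qed (auto simp: S_def indicator_def intro!: nn_integral_cong)
    also have "\<dots> \<le> (\<integral>\<^sup>+ t. ?F (\<tau> t) \<partial>lebesgue_on S)"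
    proof (rule nn_integral_mono_AE)
      show "AE t in lebesgue_on S. orlicz_term \<phi> (ennreal \<bar>f t\<bar>) (v t) \<le> ?F (\<tau> t)"
        using AE_le
      proof (rule AE_mp, intro AE_I2 impI)
        fix t assume "t \<in> space (lebesgue_on S)" "ennreal \<bar>f t\<bar> \<le> rearr_fun I f (\<tau> t)"
        then show "orlicz_term \<phi> (ennreal \<bar>f t\<bar>) (v t) \<le> ?F (\<tau> t)"
          using w0_nonneg by (simp add: v_def orlicz_term_mono)
      qed
    qed
    also have "\<dots> = (\<integral>\<^sup>+ r. ?F r \<partial>density lborel (indicator J))"
      using \<tau>(1) F unfolding distr[symmetric] by (subst nn_integral_distr) auto
    also have "\<dots> = (\<integral>\<^sup>+ r. indicator J r * ?F r \<partial>lborel)"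
      using J F by (subst nn_integral_density) auto
    also have "\<dots> = (\<integral>\<^sup>+ r. indicator J r * ?F r \<partial>lebesgue)"
      by (rule nn_integral_completion[symmetric])
    also have "\<dots> \<le> (\<integral>\<^sup>+ r. orlicz_term \<phi> (rearr_fun I f r) (w r) * indicator I r \<partial>lebesgue)"
      using J_sub by (intro nn_integral_mono) (auto simp: indicator_def w0_def)
    also have "\<dots> = (\<integral>\<^sup>+ t. orlicz_term \<phi> (rearr_fun I f t) (w t) \<partial>lebesgue_on I)"
      by (subst nn_integral_restrict_space) auto
    finally show "(\<integral>\<^sup>+ t. orlicz_term \<phi> (ennreal \<bar>f t\<bar>) (v t) \<partial>lebesgue_on I)
      \<le> (\<integral>\<^sup>+ t. orlicz_term \<phi> (rearr_fun I f t) (w t) \<partial>lebesgue_on I)" .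
  qed
qed

subsection \<open>Sequences\<close>

lemma distr_seq_eq: "distr_seq x s = emeasure (count_space UNIV) {n. s < \<bar>x (Suc n)\<bar>}"
proof -
  have "{k. 1 \<le> k \<and> \<bar>x k\<bar> > s} = Suc ` {n. s < \<bar>x (Suc n)\<bar>}"
    by (auto simp: image_iff) (metis Suc_pred less_eq_Suc_le)
  then show ?thesis
    unfolding distr_seq_def by (simp add: emeasure_count_space finite_image_iff card_image)
qed

lemma rearr_seq_le_iff:
  assumes "0 \<le> s"
  shows "rearr_seq x n \<le> ennreal s \<longleftrightarrow> distr_seq x s \<le> of_nat (n - 1)"
proof -
  have antimono: "distr_seq x r' \<le> distr_seq x r" if "r \<le> r'" for r r'
    unfolding distr_seq_def using that by (intro emeasure_mono) auto
  have right_cont: "distr_seq x s \<le> c" if "\<And>r. s < r \<Longrightarrow> distr_seq x r \<le> c" for c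
    using that emeasure_level_right_cont[of "\<lambda>n. \<bar>x (Suc n)\<bar>" "count_space UNIV" s c]
    by (simp add: distr_seq_eq)
  have "rearr_seq x n = Inf (ennreal ` {r. 0 < r \<and> distr_seq x r \<le> of_nat (n - 1)})"
    by (simp add: rearr_seq_def image_Collect)
  then show ?thesis
    using assms by (simp only:) (rule Inf_ennreal_image_le_iff, auto intro: antimono right_cont)
qed

lemma less_rearr_seq_iff: "0 \<le> s \<Longrightarrow> ennreal s < rearr_seq x n \<longleftrightarrow> of_nat (n - 1) < distr_seq x s"
  using rearr_seq_le_iff[of s x n] by (simp flip: not_le)

text \<open>The same four sets for counting measure, with indices shifted to start at 0: the entry
  at \<open>Suc n\<close> of the rearrangement exceeds \<open>s\<close> exactly when
  \<open>n < distr_seq x s\<close>.\<close>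

lemma (in orlicz) suminf_orlicz_term_rearr_seq_le:
  assumes w: "weight_sequence w" and v: "\<And>n. 1 \<le> n \<Longrightarrow> 0 \<le> v n"
    and le: "\<And>n. 1 \<le> n \<Longrightarrow> rearr_seq v n \<le> ennreal (w n)"
  shows "(\<Sum>n. orlicz_term \<phi> (rearr_seq x (Suc n)) (w (Suc n))) \<le> (\<Sum>n. orlicz_term \<phi> (ennreal \<bar>x (Suc n)\<bar>) (v (Suc n)))"
  unfolding nn_integral_count_space_nat[symmetric]
proof (rule nn_integral_orlicz_term_le)
  have w': "0 \<le> w (Suc n)" "m \<le> n \<Longrightarrow> w (Suc n) \<le> w (Suc m)" for m n
    using w by (auto simp: weight_sequence_def monotone_on_def)
  fix s :: real and D
  assume s: "0 \<le> s" and D: "\<And>x y. y \<in> D \<Longrightarrow> 0 \<le> x \<Longrightarrow> x \<le> y \<Longrightarrow> x \<in> (D :: real set)"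
  let ?M = "count_space (UNIV :: nat set)"
  let ?P = "{n. of_nat n < distr_seq x s}"
  let ?Q = "{n. w (Suc n) \<notin> D}"
  let ?A = "{n. s < \<bar>x (Suc n)\<bar>}"
  let ?E = "{n. v (Suc n) \<notin> D}"
  have Q_initial: "m \<in> ?Q" if "n \<in> ?Q" "m \<le> n" for m n
    using that D[of "w (Suc m)" "w (Suc n)"] w' by auto
  have P_initial: "m \<in> ?P" if "n \<in> ?P" "m \<le> n" for m n
    using that le_less_trans[of "of_nat m" "of_nat n :: ennreal" "distr_seq x s"] by simp
  have "emeasure ?M (?P - ?Q) \<le> emeasure ?M (?A - ?E)"
  proof (rule emeasure_Diff_nested_le)
    show "?P \<subseteq> ?Q \<or> ?Q \<subseteq> ?P"
      using P_initial Q_initial by (meson linear subsetI)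
    show "?P \<subseteq> ?Q" if inf: "emeasure ?M ?Q = \<infinity>"
    proof
      fix n
      show "n \<in> ?Q"
      proof (rule ccontr)
        assume "n \<notin> ?Q"
        then have "?Q \<subseteq> {..<n}"
          using Q_initial not_less by blast
        then have "finite ?Q"
          using finite_subset by blast
        with inf show False
          by simp
      qed
    qed
    show "emeasure ?M ?P \<le> emeasure ?M ?A"
    proof (cases "finite ?A")
      case True
      then have "distr_seq x s = of_nat (card ?A)"
        by (simp add: distr_seq_eq)
      then have "?P = {..<card ?A}"
        by auto
      then show ?thesis
        using True by simp
    qed simp
    show "emeasure ?M ?E \<le> emeasure ?M ?Q"
    proof (cases "?Q = UNIV")
      case False
      \<comment> \<open>\<open>b\<close> is both the first index outside \<open>?Q\<close> and the
        size of \<open>?Q\<close>. A value of \<open>v\<close> outside \<open>D\<close> exceeds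
        \<open>w (Suc b)\<close>, and the bound on the rearrangement at \<open>Suc b\<close> allows
        at most \<open>b\<close> of those.\<close>
      define b where "b = (LEAST n. n \<notin> ?Q)"
      have b: "b \<notin> ?Q"
        using False unfolding b_def by (metis (mono_tags, lifting) LeastI UNIV_eq_I)
      have "?Q = {..<b}"
        using Q_initial b not_less_Least[of _ "\<lambda>n. n \<notin> ?Q", folded b_def]
        by (auto simp: not_less[symmetric])
      then have Q: "emeasure ?M ?Q = of_nat b"
        by simp
      have "emeasure ?M ?E \<le> distr_seq v (w (Suc b))"
        unfolding distr_seq_eq using D[of "w (Suc b)"] v b by (intro emeasure_mono) (auto simp flip: not_le)
      also have "\<dots> \<le> of_nat b"
        using rearr_seq_le_iff[of "w (Suc b)" v "Suc b"] le[of "Suc b"] w'(1) by simp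
      finally show ?thesis
        by (simp only: Q)
    qed simp
  qed simp_all
  moreover have "?P - ?Q = {n. ennreal s < rearr_seq x (Suc n) \<and> w (Suc n) \<in> D}"
    "?A - ?E = {n. ennreal s < ennreal \<bar>x (Suc n)\<bar> \<and> v (Suc n) \<in> D}"
    using s by (auto simp: less_rearr_seq_iff ennreal_less_iff)
  ultimately show "emeasure ?M {n \<in> space ?M. ennreal s < rearr_seq x (Suc n) \<and> w (Suc n) \<in> D}
    \<le> emeasure ?M {n \<in> space ?M. ennreal s < ennreal \<bar>x (Suc n)\<bar> \<and> v (Suc n) \<in> D}"
    by simp
qed (use w v in \<open>auto simp: weight_sequence_def intro: sigma_finite_measure_count_space\<close>)

section \<open>Attaining the infimum for sequences\<close>

lemma (in orlicz) finite_level_seq: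
  assumes w: "weight_sequence w"
    and finite: "(\<Sum>n. orlicz_term \<phi> (rearr_seq x (Suc n)) (w (Suc n))) < \<infinity>"
    and s: "0 < s"
  shows "finite {n. s < \<bar>x (Suc n)\<bar>}"
proof (rule ccontr)
  assume "\<not> ?thesis"
  then have inf: "distr_seq x s = \<infinity>"
    by (simp add: distr_seq_eq)
  have w': "0 \<le> w (Suc n)" "w (Suc n) \<le> w 1" for n
    using w by (auto simp: weight_sequence_def monotone_on_def)
  define c where "c = orlicz_term \<phi> (ennreal s) (w 1 + 1)"
  have w1: "0 < w 1 + 1"
    using w'(1)[of 0] by simp
  then have "0 < c"
    using s phi_less[of 0 "s / (w 1 + 1)"] by (auto simp: c_def orlicz_term_ennreal)
  have "c \<le> orlicz_term \<phi> (rearr_seq x (Suc n)) (w (Suc n))" for n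
  proof -
    have "c \<le> orlicz_term \<phi> (ennreal s) (w (Suc n))"
      unfolding c_def using w'[of n] by (intro orlicz_term_antimono) auto
    also have "\<dots> \<le> orlicz_term \<phi> (rearr_seq x (Suc n)) (w (Suc n))"
      using less_rearr_seq_iff[of s x "Suc n"] s inf w'(1)
      by (intro orlicz_term_mono) (auto simp: less_imp_le of_nat_less_top)
    finally show ?thesis .
  qed
  then have "(\<Sum>n::nat. c) \<le> (\<Sum>n. orlicz_term \<phi> (rearr_seq x (Suc n)) (w (Suc n)))"
    by (intro suminf_le) auto
  moreover have "(\<Sum>n::nat. c) = \<infinity>"
    unfolding nn_integral_count_space_nat[symmetric] using \<open>0 < c\<close> by (simp add: ennreal_mult_top)
  ultimately show False
    using finite by (simp add: top_unique)
qed

text \<open>Here the rank is the number of predecessors and is injective on the support, so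
  injectivity takes over the role of measure preservation.\<close>

lemma (in orlicz) exists_le_suminf_rearr_seq:
  assumes w: "weight_sequence w"
    and finite: "(\<Sum>n. orlicz_term \<phi> (rearr_seq x (Suc n)) (w (Suc n))) < \<infinity>"
  obtains v where "\<And>n. 1 \<le> n \<Longrightarrow> rearr_seq v n \<le> ennreal (w n)" "\<And>n. 1 \<le> n \<Longrightarrow> 0 \<le> v n"
    "(\<Sum>n. orlicz_term \<phi> (ennreal \<bar>x (Suc n)\<bar>) (v (Suc n)))
      \<le> (\<Sum>n. orlicz_term \<phi> (rearr_seq x (Suc n)) (w (Suc n)))"
proof -
  define y where "y n = \<bar>x (Suc n)\<bar>" for n
  define before where "before n = {m. y n < y m \<or> y m = y n \<and> m < n}" for n
  define S where "S = {n. 0 < y n}"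
  define \<tau> where "\<tau> n = card (before n)" for n
  have w': "0 \<le> w (Suc n)" "m \<le> n \<Longrightarrow> w (Suc n) \<le> w (Suc m)" for m n
    using w by (auto simp: weight_sequence_def monotone_on_def)
  have finite_level: "finite {n. s < y n}" if "0 < s" for s
    unfolding y_def using finite_level_seq[OF w finite that] .
  have finite_before: "finite (before n)" if "n \<in> S" for n
  proof (rule finite_subset)
    show "before n \<subseteq> {m. y n / 2 < y m}"
      using that by (auto simp: before_def S_def)
    show "finite {m. y n / 2 < y m}"
      using that by (intro finite_level) (simp add: S_def)
  qed
  have before_less: "\<tau> n < \<tau> m" if "n \<in> before m" "m \<in> S" for n m
    unfolding \<tau>_def
  proof (rule psubset_card_mono[OF finite_before[OF that(2)]])
    show "before n \<subset> before m"
      using that(1) by (fastforce simp: before_def)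
  qed
  have inj: "inj_on \<tau> S"
  proof (rule inj_onI, rule ccontr)
    fix n m assume nm: "n \<in> S" "m \<in> S" "\<tau> n = \<tau> m" "n \<noteq> m"
    then have "n \<in> before m \<or> m \<in> before n"
      by (auto simp: before_def)
    with nm before_less show False
      by fastforce
  qed
  \<comment> \<open>Ranks count from 0 and weights from 1, hence
    \<open>Suc (\<tau> n)\<close>.\<close>
  define v where "v k = (case k of 0 \<Rightarrow> 0 | Suc n \<Rightarrow> if n \<in> S then w (Suc (\<tau> n)) else 0)" for k
  show ?thesis
  proof (rule that[of v])
    fix k :: nat assume "1 \<le> k"
    then obtain n where k: "k = Suc n"
      by (cases k) auto
    show "0 \<le> v k"
      using w' by (simp add: k v_def)
    \<comment> \<open>Only ranks below \<open>n\<close> can carry a weight above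
      \<open>w (Suc n)\<close>, and by injectivity there are at most \<open>n\<close> of
      them.\<close>
    have "{m. w (Suc n) < \<bar>v (Suc m)\<bar>} \<subseteq> {m \<in> S. \<tau> m < n}"
      using w' by (fastforce simp: v_def not_le[symmetric] split: if_splits)
    then have "distr_seq v (w (Suc n)) \<le> emeasure (count_space UNIV) {m \<in> S. \<tau> m < n}"
      unfolding distr_seq_eq by (intro emeasure_mono) auto
    also have "\<dots> \<le> of_nat n"
    proof -
      have inj': "inj_on \<tau> {m \<in> S. \<tau> m < n}"
        using inj by (rule inj_on_subset) auto
      have sub: "\<tau> ` {m \<in> S. \<tau> m < n} \<subseteq> {..<n}"
        by auto
      show ?thesis
        using inj_on_finite[OF inj' sub] card_inj_on_le[OF inj' sub] by simp
    qed
    finally show "rearr_seq v k \<le> ennreal (w k)"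
      using rearr_seq_le_iff[OF w'(1), of v k] by (simp add: k)
  next
    let ?F = "\<lambda>n. orlicz_term \<phi> (rearr_seq x (Suc n)) (w (Suc n))"
    have rearr: "ennreal (y n) \<le> rearr_seq x (Suc (\<tau> n))" if n: "n \<in> S" for n
    proof (rule ccontr)
      assume "\<not> ?thesis"
      then have "rearr_seq x (Suc (\<tau> n)) < ennreal (y n)"
        by simp
      then obtain z where z: "rearr_seq x (Suc (\<tau> n)) = ennreal z" "0 \<le> z" "z < y n"
        by (cases "rearr_seq x (Suc (\<tau> n))") (auto simp: ennreal_less_iff)
      \<comment> \<open>Together with its predecessors, \<open>n\<close> gives
        \<open>\<tau> n + 1\<close> entries above \<open>z\<close>, one more than a rearrangement of
        value \<open>z\<close> at \<open>Suc (\<tau> n)\<close> permits.\<close>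
      have "finite (insert n (before n))" "card (insert n (before n)) = Suc (\<tau> n)"
        using finite_before[OF n] by (simp_all add: \<tau>_def before_def)
      then have "of_nat (Suc (\<tau> n)) = emeasure (count_space UNIV) (insert n (before n))"
        by (simp only: emeasure_count_space_finite subset_UNIV)
      also have "\<dots> \<le> distr_seq x z"
        unfolding distr_seq_eq using z(3) by (intro emeasure_mono) (auto simp: before_def y_def)
      also have "\<dots> \<le> of_nat (\<tau> n)"
        using rearr_seq_le_iff[OF z(2), of x "Suc (\<tau> n)"] z(1) by simp
      finally show False
        by (simp only: of_nat_le_iff)
    qed
    have "(\<Sum>n. orlicz_term \<phi> (ennreal \<bar>x (Suc n)\<bar>) (v (Suc n)))
      = (\<integral>\<^sup>+ n. orlicz_term \<phi> (ennreal (y n)) (v (Suc n)) \<partial>count_space UNIV)"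
      by (simp add: nn_integral_count_space_nat y_def)
    also have "\<dots> = (\<integral>\<^sup>+ n. orlicz_term \<phi> (ennreal (y n)) (v (Suc n)) \<partial>count_space S)"
      by (rule nn_integral_count_space_eq) (auto simp: S_def y_def)
    also have "\<dots> \<le> (\<integral>\<^sup>+ n. ?F (\<tau> n) \<partial>count_space S)"
      using rearr w' by (intro nn_integral_mono) (auto simp: v_def intro!: orlicz_term_mono)
    also have "\<dots> = (\<integral>\<^sup>+ n. ?F n \<partial>count_space (\<tau> ` S))"
      using inj by (intro nn_integral_bij_count_space) (rule inj_on_imp_bij_betw)
    also have "\<dots> = (\<integral>\<^sup>+ n. ?F n * indicator (\<tau> ` S) n \<partial>count_space UNIV)"
      by (simp add: restrict_count_space flip: nn_integral_restrict_space)
    also have "\<dots> \<le> (\<integral>\<^sup>+ n. ?F n \<partial>count_space UNIV)"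
      by (intro nn_integral_mono) (simp add: indicator_def)
    finally show "(\<Sum>n. orlicz_term \<phi> (ennreal \<bar>x (Suc n)\<bar>) (v (Suc n))) \<le> (\<Sum>n. ?F n)"
      by (simp add: nn_integral_count_space_nat)
  qed
qed

subsection \<open>The main identity\<close>

theorem corollary2p11:
  fixes \<phi> :: "real \<Rightarrow> real"
  assumes "orlicz_function \<phi>"
  shows
    "(\<forall>(a :: ereal) (I :: real set) (w :: real \<Rightarrow> real) (f :: real \<Rightarrow> real).
        0 < a \<longrightarrow> I = einterval 0 a \<longrightarrow> weight_function I w \<longrightarrow> f \<in> L0 I \<longrightarrow>
        (\<integral>\<^sup>+ t. orlicz_term \<phi> (rearr_fun I f t) (w t) \<partial>lebesgue_on I) =
        (INF v \<in> {v \<in> L0 I. (\<forall>t\<in>I. rearr_fun I v t \<le> ennreal (w t)) \<and> (\<forall>t\<in>I. 0 \<le> v t)}.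
           \<integral>\<^sup>+ t. orlicz_term \<phi> (ennreal \<bar>f t\<bar>) (v t) \<partial>lebesgue_on I))
   \<and>
     (\<forall>(w :: nat \<Rightarrow> real) (x :: nat \<Rightarrow> real).
        weight_sequence w \<longrightarrow>
        (\<Sum>n. orlicz_term \<phi> (rearr_seq x (Suc n)) (w (Suc n))) =
        (INF v \<in> {v. (\<forall>n\<ge>1. rearr_seq v n \<le> ennreal (w n)) \<and> (\<forall>n\<ge>1. 0 \<le> v n)}.
           \<Sum>n. orlicz_term \<phi> (ennreal \<bar>x (Suc n)\<bar>) (v (Suc n))))"
proof (intro conjI allI impI)
  interpret orlicz \<phi>
    by standard fact
  fix a :: ereal and I :: "real set" and w f :: "real \<Rightarrow> real"
  assume I: "I = einterval 0 a" and w: "weight_function I w" and f: "f \<in> L0 I"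
  let ?V = "{v \<in> L0 I. (\<forall>t\<in>I. rearr_fun I v t \<le> ennreal (w t)) \<and> (\<forall>t\<in>I. 0 \<le> v t)}"
  let ?L = "\<integral>\<^sup>+ t. orlicz_term \<phi> (rearr_fun I f t) (w t) \<partial>lebesgue_on I"
  let ?R = "\<lambda>v. \<integral>\<^sup>+ t. orlicz_term \<phi> (ennreal \<bar>f t\<bar>) (v t) \<partial>lebesgue_on I"
  show "?L = (INF v\<in>?V. ?R v)"
  proof (rule antisym)
    show "?L \<le> (INF v\<in>?V. ?R v)"
      by (intro INF_greatest nn_integral_orlicz_term_rearr_fun_le[OF I w f]) auto
    show "(INF v\<in>?V. ?R v) \<le> ?L"
    proof (cases "?L < \<infinity>")
      case True
      obtain v where "v \<in> L0 I" "\<And>t. t \<in> I \<Longrightarrow> rearr_fun I v t \<le> ennreal (w t)"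
        "\<And>t. t \<in> I \<Longrightarrow> 0 \<le> v t" "?R v \<le> ?L"
        using exists_le_nn_integral_rearr_fun[OF I w f True] by blast
      then show ?thesis
        by (intro INF_lower2[of v]) auto
    qed (simp add: not_less top_unique)
  qed
next
  interpret orlicz \<phi>
    by standard fact
  fix w x :: "nat \<Rightarrow> real"
  assume w: "weight_sequence w"
  let ?V = "{v. (\<forall>n\<ge>1. rearr_seq v n \<le> ennreal (w n)) \<and> (\<forall>n\<ge>1. 0 \<le> v n)}"
  let ?L = "\<Sum>n. orlicz_term \<phi> (rearr_seq x (Suc n)) (w (Suc n))"
  let ?R = "\<lambda>v. \<Sum>n. orlicz_term \<phi> (ennreal \<bar>x (Suc n)\<bar>) (v (Suc n))"
  show "?L = (INF v\<in>?V. ?R v)"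
  proof (rule antisym)
    show "?L \<le> (INF v\<in>?V. ?R v)"
      by (intro INF_greatest suminf_orlicz_term_rearr_seq_le[OF w]) auto
    show "(INF v\<in>?V. ?R v) \<le> ?L"
    proof (cases "?L < \<infinity>")
      case True
      obtain v where "\<And>n. 1 \<le> n \<Longrightarrow> rearr_seq v n \<le> ennreal (w n)" "\<And>n. 1 \<le> n \<Longrightarrow> 0 \<le> v n"
        "?R v \<le> ?L"
        using exists_le_suminf_rearr_seq[OF w True] by blast
      then show ?thesis
        by (intro INF_lower2[of v]) auto
    qed (simp add: not_less top_unique)
  qed
qed

end
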